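(* Let $p>1$, $f(n)=n^p$ for $n\in\mathbb{N}$, and let $(x,y)\in\mathbb{N}^2$ and $0<\alpha<1/2$ be fixed. Let $c>0$ be the constant (depending only on $x$, $y$ and $f$) such that, for the two-bin balls-in-bins process with feedback function $f$, $\mathbf{Pr}_{(x,y)}(L>n)\sim c\sum_{j=n}^{+\infty}\frac{1}{f(j)}$ as $n\to+\infty$ (such a constant exists). Then, as $n\to+\infty$, $$\mathbf{Pr}_{(x,y)}(\mathsf{LoserHasMoreThan}(\alpha,n))\sim\frac{c\left(\alpha^{1-p}-(1-\alpha)^{1-p}\right)}{(p-1)\,n^{p-1}}.$$
   Context: $\mathbb{N}=\{1,2,3,\dots\}$; $a_n\sim b_n$ means $a_n/b_n\to 1$. The existence of $c$ is part of what is asserted. Two-bin balls-in-bins process with feedback function $f:\mathbb{N}\to(0,+\infty)$: the discrete-time Markov chain $\{(I_1(m),I_2(m))\}_{m\geq 0}$ on $\mathbb{N}^2$ in which at each time $m\ge 1$ exactly one ball is added, to bin $i_m\in\{1,2\}$ (so $I_{i_m}(m)=I_{i_m}(m-1)+1$ and the other coordinate is unchanged), where, conditionally on the past, $i_m=i$ with probability $f(I_i(m-1))/(f(I_1(m-1))+f(I_2(m-1)))$. $\mathbf{Pr}_{u}$ denotes probability when the initial state $(I_1(0),I_2(0))$ is $u\in\mathbb{N}^2$. When $\sum_j f(j)^{-1}<+\infty$, it is known that almost surely exactly one bin receives all but finitely many of the balls. The other bin is called the losing bin, and the losing number $L$ is the (almost surely finite) final number of balls in the losing bin, i.e. $L=\lim_{m\to\infty}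 I_i(m)$ for $i$ the losing bin. $\mathsf{LoserHasMoreThan}(\alpha,n)$ is the event that, at the time the total number of balls in the system reaches $n$, the number of balls in the losing bin is at least $\alpha n$. *)

theory Defs
  imports "HOL-Probability.Probability"
begin

datatype bin = Bin1 | Bin2

primrec other :: "bin \<Rightarrow> bin" where
  "other Bin1 = Bin2"
| "other Bin2 = Bin1"

type_synonym state = "nat \<times> nat"

primrec balls :: "bin \<Rightarrow> state \<Rightarrow> nat" where
  "balls Bin1 s = fst s"
| "balls Bin2 s = snd s"

primrec add_ball :: "bin \<Rightarrow> state \<Rightarrow> state" where
  "add_ball Bin1 s = (Suc (fst s), snd s)"
| "add_ball Bin2 s = (fst s, Suc (snd s))"

text \<open>
  Feedback functions are only ever evaluated at positive arguments along the process started from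
  a state with positive coordinates; the value at 0 is irrelevant.
\<close>

definition bin_pmf :: "(nat \<Rightarrow> real) \<Rightarrow> state \<Rightarrow> bin pmf" where
  "bin_pmf f s = map_pmf (\<lambda>b. if b then Bin1 else Bin2)
     (bernoulli_pmf (f (balls Bin1 s) / (f (balls Bin1 s) + f (balls Bin2 s))))"

definition step_pmf :: "(nat \<Rightarrow> real) \<Rightarrow> state \<Rightarrow> state pmf" where
  "step_pmf f s = map_pmf (\<lambda>i. add_ball i s) (bin_pmf f s)"

text \<open>
  The law of the Markov chain on the space of trajectories \<open>\<omega> :: nat \<Rightarrow> state\<close>, obtained from the
  Ionescu-Tulcea theorem. The kernel at index \<open>m\<close> is the conditional law of the \<open>m\<close>-th state
  given the states with indices in \<open>{0..<m}\<close>.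
\<close>

definition bb_kernel :: "(nat \<Rightarrow> real) \<Rightarrow> state \<Rightarrow> nat \<Rightarrow> (nat \<Rightarrow> state) \<Rightarrow> state measure" where
  "bb_kernel f u m \<omega> =
     measure_pmf (case m of 0 \<Rightarrow> return_pmf u | Suc k \<Rightarrow> step_pmf f (\<omega> k))"

definition bb_process :: "(nat \<Rightarrow> real) \<Rightarrow> state \<Rightarrow> (nat \<Rightarrow> state) measure" where
  "bb_process f u =
     projective_family.lim UNIV (Ionescu_Tulcea.CI (bb_kernel f u) (\<lambda>_. count_space UNIV))
       (\<lambda>_. count_space UNIV)"

definition receives :: "bin \<Rightarrow> (nat \<Rightarrow> state) \<Rightarrow> nat \<Rightarrow> bool" where
  "receives i \<omega> m \<longleftrightarrow> \<omega> (Suc m) = add_ball i (\<omega> m)"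

definition winning :: "bin \<Rightarrow> (nat \<Rightarrow> state) \<Rightarrow> bool" where
  "winning i \<omega> \<longleftrightarrow> finite {m. \<not> receives i \<omega> m}"

text \<open>
  On the exceptional trajectories where no bin receives all but finitely many balls the following
  two functions return unspecified (but fixed) values; when the reciprocals of the feedback
  function are summable these trajectories form a null set.
\<close>

definition losing_bin :: "(nat \<Rightarrow> state) \<Rightarrow> bin" where
  "losing_bin \<omega> = other (THE i. winning i \<omega>)"

definition losing_number :: "(nat \<Rightarrow> state) \<Rightarrow> nat" where
  "losing_number \<omega> = lim (\<lambda>m. balls (losing_bin \<omega>) (\<omega> m))"

text \<open>
  The total number of balls grows by one in each step, so the time \<open>m\<close> below is almost surely
  unique, and it exists as soon as \<open>n\<close> is at least the initial number of balls.
\<close>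

definition loser_has_more_than :: "real \<Rightarrow> nat \<Rightarrow> (nat \<Rightarrow> state) \<Rightarrow> bool" where
  "loser_has_more_than \<alpha> n \<omega> \<longleftrightarrow>
     (\<exists>m. balls Bin1 (\<omega> m) + balls Bin2 (\<omega> m) = n \<and>
          real (balls (losing_bin \<omega>) (\<omega> m)) \<ge> \<alpha> * real n)"

section \<open>The trajectory measure is the law of the Markov chain\<close>

lemma pmf_step_pmf:
  assumes "0 < f (balls Bin1 s)" "0 < f (balls Bin2 s)"
  shows "pmf (step_pmf f s) (add_ball i s) =
           f (balls i s) / (f (balls Bin1 s) + f (balls Bin2 s))"
proof -
  have p: "0 \<le> f (balls Bin1 s) / (f (balls Bin1 s) + f (balls Bin2 s))"
       "f (balls Bin1 s) / (f (balls Bin1 s) + f (balls Bin2 s)) \<le> 1"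
    using assms by auto
  have inj: "inj (\<lambda>i. add_ball i s)"
  proof (rule injI)
    fix a b show "add_ball a s = add_ball b s \<Longrightarrow> a = b" by (cases a; cases b) auto
  qed
  have inj': "inj (\<lambda>b. if b then Bin1 else Bin2)" by (auto simp: inj_def)
  have "pmf (step_pmf f s) (add_ball i s) = pmf (bin_pmf f s) i"
    unfolding step_pmf_def using pmf_map_inj'[OF inj] by simp
  also have "\<dots> = pmf (bin_pmf f s) ((\<lambda>b. if b then Bin1 else Bin2) (i = Bin1))"
    by (cases i) auto
  also have "\<dots> = pmf (bernoulli_pmf (f (balls Bin1 s) / (f (balls Bin1 s) + f (balls Bin2 s))))
                     (i = Bin1)"
    unfolding bin_pmf_def using pmf_map_inj'[OF inj'] by simp
  also have "\<dots> = f (balls i s) / (f (balls Bin1 s) + f (balls Bin2 s))"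
    using p assms by (cases i) (auto simp: field_simps)
  finally show ?thesis .
qed

context
  fixes f :: "nat \<Rightarrow> real" and u :: state
begin

interpretation IT: Ionescu_Tulcea "bb_kernel f u" "\<lambda>_. count_space UNIV"
proof (rule Ionescu_Tulcea.intro)
  fix i
  have step: "(\<lambda>s. measure_pmf (step_pmf f s))
      \<in> measurable (count_space UNIV) (subprob_algebra (count_space UNIV))"
    by (simp add: Pi_iff measure_pmf_in_subprob_algebra)
  show "bb_kernel f u i \<in> Pi\<^sub>M {0..<i} (\<lambda>_. count_space UNIV) \<rightarrow>\<^sub>M subprob_algebra (count_space UNIV)"
  proof (cases i)
    case 0
    then show ?thesis
      by (simp add: bb_kernel_def[abs_def] measure_pmf_in_subprob_algebra)
  next
    case (Suc k)
    have "(\<lambda>\<omega>. \<omega> k) \<in> measurable (Pi\<^sub>M {0..<i} (\<lambda>_. count_space UNIV)) (count_space UNIV)"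
      using Suc by (intro measurable_component_singleton) auto
    from measurable_compose[OF this step] Suc show ?thesis
      by (simp add: bb_kernel_def[abs_def])
  qed
next
  fix i x
  show "prob_space (bb_kernel f u i x)"
    by (simp add: bb_kernel_def measure_pmf.prob_space_axioms)
qed

lemma bb_process_IT: "bb_process f u = IT.PF.lim"
  by (simp add: bb_process_def)

lemma sets_bb_process [measurable_cong]:
  "sets (bb_process f u) = sets (Pi\<^sub>M UNIV (\<lambda>_. count_space UNIV))"
  by (simp add: bb_process_IT)

lemma space_bb_process [simp]: "space (bb_process f u) = UNIV"
  using sets_eq_imp_space_eq[OF sets_bb_process] by (simp add: space_PiM)

lemma measurable_bb_state [measurable]:
  "(\<lambda>\<omega>. \<omega> m) \<in> measurable (bb_process f u) (count_space UNIV)"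
  by measurable

lemma cylinder_C:
  "emeasure (bb_process f u) {\<omega>. \<forall>k<n. \<omega> k = h k} =
     emeasure (IT.C 0 n (\<lambda>_. undefined)) {restrict h {0..<n}}"
proof -
  let ?M = "\<lambda>_::nat. count_space (UNIV :: state set)"
  have X: "{restrict h {0..<n}} \<in> sets (Pi\<^sub>M {0..<n} ?M)"
  proof -
    have "{restrict h {0..<n}} = Pi\<^sub>E {0..<n} (\<lambda>k. {h k})"
      by (auto simp: PiE_iff extensional_def restrict_def fun_eq_iff)
    then show ?thesis by (auto intro!: sets_PiM_I_finite)
  qed
  have "{\<omega>. \<forall>k<n. \<omega> k = h k} = IT.PF.emb UNIV {0..<n} {restrict h {0..<n}}"
    by (auto simp: prod_emb_def space_PiM restrict_def fun_eq_iff) metis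
  then have "emeasure (bb_process f u) {\<omega>. \<forall>k<n. \<omega> k = h k} = emeasure (IT.CI {0..<n}) {restrict h {0..<n}}"
    using IT.lim[OF _ X] by (simp add: bb_process_IT)
  also have "\<dots> = emeasure (IT.C 0 n (\<lambda>_. undefined)) (IT.PF.emb {0..<n} {0..<n} {restrict h {0..<n}})"
    by (rule IT.emeasure_CI[OF _ X]) simp
  also have "IT.PF.emb {0..<n} {0..<n} {restrict h {0..<n}} = {restrict h {0..<n}}"
    using X sets.sets_into_space[OF X] by (auto simp: prod_emb_id space_PiM)
  finally show ?thesis .
qed

lemma emeasure_cylinder_Suc:
  "emeasure (bb_process f u) {\<omega>. \<forall>k<Suc n. \<omega> k = h k} =
     emeasure (bb_process f u) {\<omega>. \<forall>k<n. \<omega> k = h k} * emeasure (bb_kernel f u n h) {h n}"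
proof -
  let ?M = "\<lambda>_::nat. count_space (UNIV :: state set)"
  let ?r = "\<lambda>n. restrict h {0..<n}"
  let ?C = "IT.C 0 n (\<lambda>_. undefined)"
  have X: "{?r n} \<in> sets (Pi\<^sub>M {0..<n} ?M)" for n
  proof -
    have "{?r n} = Pi\<^sub>E {0..<n} (\<lambda>k. {h k})"
      by (auto simp: PiE_iff extensional_def restrict_def fun_eq_iff)
    then show ?thesis by (auto intro!: sets_PiM_I_finite)
  qed
  have u0: "(\<lambda>_. undefined) \<in> space (Pi\<^sub>M {0..<0} ?M)" by (simp add: space_PiM)
  have spC: "space ?C = space (Pi\<^sub>M {0..<n} ?M)" using IT.space_C[OF u0, of n] by simp
  have stC: "sets ?C = sets (Pi\<^sub>M {0..<n} ?M)" using IT.sets_C[OF u0, of n] by simp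
  have ne: "space ?C \<noteq> {}" using spC X[of n] sets.sets_into_space by fastforce
  have kern: "bb_kernel f u n (?r n) = bb_kernel f u n h"
    by (auto simp: bb_kernel_def split: nat.split)
  have ep: "emeasure (IT.eP n \<omega>) {?r (Suc n)} =
        emeasure (bb_kernel f u n h) {h n} * indicator {?r n} \<omega>"
    if w: "\<omega> \<in> space ?C" for \<omega>
  proof -
    have w': "\<omega> \<in> space (Pi\<^sub>M {0..<n} ?M)" using w spC by simp
    have ext: "\<omega> \<in> extensional {0..<n}" using w' by (auto simp: space_PiM PiE_def)
    have eq: "fun_upd \<omega> n s = ?r (Suc n) \<longleftrightarrow> s = h n \<and> \<omega> = ?r n" for s
    proof
      assume a: "fun_upd \<omega> n s = ?r (Suc n)"
      have "s = h n" using fun_cong[OF a, of n] by simp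
      moreover have "\<omega> k = ?r n k" for k
        using fun_cong[OF a, of k] ext by (cases "k < n") (auto simp: extensional_def)
      ultimately show "s = h n \<and> \<omega> = ?r n" by auto
    qed (auto simp: restrict_def fun_eq_iff)
    have "emeasure (IT.eP n \<omega>) {?r (Suc n)} = emeasure (bb_kernel f u n \<omega>) {s. fun_upd \<omega> n s = ?r (Suc n)}"
      using IT.emeasure_eP[OF w' X[of "Suc n"]] by (simp add: vimage_def)
    also have "\<dots> = emeasure (bb_kernel f u n h) {h n} * indicator {?r n} \<omega>"
    proof -
      have "{s. fun_upd \<omega> n s = ?r (Suc n)} = (if \<omega> = ?r n then {h n} else {})"
        using eq by auto
      note S = this
      show ?thesis unfolding S using kern by (cases "\<omega> = ?r n") simp_all
    qed
    finally show ?thesis .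
  qed
  have "emeasure (bb_process f u) {\<omega>. \<forall>k<Suc n. \<omega> k = h k} =
      emeasure (?C \<bind> IT.eP n) {?r (Suc n)}"
    by (simp only: cylinder_C IT.C.simps add_0)
  also have "\<dots> = (\<integral>\<^sup>+\<omega>. emeasure (IT.eP n \<omega>) {?r (Suc n)} \<partial>?C)"
    using IT.measurable_eP[of n]
    by (intro emeasure_bind[OF ne _ X[of "Suc n"]]) (simp only: measurable_cong_sets[OF stC refl])
  also have "\<dots> = (\<integral>\<^sup>+\<omega>. emeasure (bb_kernel f u n h) {h n} * indicator {?r n} \<omega> \<partial>?C)"
    by (intro nn_integral_cong ep)
  also have "\<dots> = emeasure (bb_kernel f u n h) {h n} * emeasure ?C {?r n}"
    using X[of n] stC by (intro nn_integral_cmult_indicator) auto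
  finally show ?thesis by (simp add: cylinder_C mult.commute)
qed

lemma prob_space_bb_process: "prob_space (bb_process f u)"
proof
  have "emeasure (bb_process f u) {\<omega>. \<forall>k<0. \<omega> k = undefined k} = 1"
    by (subst cylinder_C) (simp add: PiM_empty restrict_def)
  then show "emeasure (bb_process f u) (space (bb_process f u)) = 1" by simp
qed

lemma bb_process_initial: "measure (bb_process f u) {\<omega>. \<omega> 0 = u} = 1"
proof -
  have "emeasure (bb_process f u) {\<omega>. \<omega> 0 = u} = 1"
    using emeasure_cylinder_Suc[of 0 "\<lambda>_. u"] prob_space.emeasure_space_1[OF prob_space_bb_process]
    by (simp add: bb_kernel_def emeasure_pmf_single)
  then show ?thesis by (simp add: measure_def)
qed

lemma bb_process_Markov:
  "measure (bb_process f u) {\<omega>. \<forall>k\<le>Suc m. \<omega> k = h k} =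
     measure (bb_process f u) {\<omega>. \<forall>k\<le>m. \<omega> k = h k} * pmf (step_pmf f (h m)) (h (Suc m))"
  using emeasure_cylinder_Suc[of "Suc m" h]
  by (simp add: measure_def less_Suc_eq_le bb_kernel_def emeasure_pmf_single enn2real_mult)

lemma measurable_winning [measurable]: "Measurable.pred (bb_process f u) (winning i)"
proof -
  have "winning i = (\<lambda>\<omega>. \<exists>N. \<forall>m>N. receives i \<omega> m)"
    by (auto simp: winning_def fun_eq_iff finite_nat_set_iff_bounded_le not_le) (metis not_le)+
  then show ?thesis unfolding receives_def by simp
qed

lemma measurable_losing_bin [measurable]:
  "losing_bin \<in> measurable (bb_process f u) (count_space UNIV)"
proof -
  have eq: "losing_bin = (\<lambda>\<omega>. other (if winning Bin1 \<omega> then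
            (if winning Bin2 \<omega> then (THE i::bin. True) else Bin1)
          else (if winning Bin2 \<omega> then Bin2 else (THE i::bin. False))))"
  proof
    fix \<omega>
    have "winning i \<omega> \<longleftrightarrow> (if i = Bin1 then winning Bin1 \<omega> else winning Bin2 \<omega>)" for i
      by (cases i) auto
    then have "(\<lambda>i. winning i \<omega>) = (\<lambda>i. if i = Bin1 then winning Bin1 \<omega> else winning Bin2 \<omega>)"
      by auto
    moreover have "(THE i. i \<noteq> Bin1) = Bin2"
      by (rule the_equality) (auto intro: bin.exhaust)
    ultimately show "losing_bin \<omega> = other (if winning Bin1 \<omega> then
            (if winning Bin2 \<omega> then (THE i::bin. True) else Bin1)
          else (if winning Bin2 \<omega> then Bin2 else (THE i::bin. False)))"
      by (auto simp: losing_bin_def)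
  qed
  have "Measurable.pred (bb_process f u) (winning Bin1)"
    "Measurable.pred (bb_process f u) (winning Bin2)"
    by (rule measurable_winning)+
  note [measurable] = this
  show ?thesis unfolding eq by measurable
qed

lemma measurable_losing_count [measurable]:
  "(\<lambda>\<omega>. balls (losing_bin \<omega>) (\<omega> m)) \<in> measurable (bb_process f u) (count_space UNIV)"
proof -
  have "(\<lambda>\<omega>. balls (losing_bin \<omega>) (\<omega> m)) =
      (\<lambda>\<omega>. if losing_bin \<omega> = Bin1 then fst (\<omega> m) else snd (\<omega> m))"
  proof
    fix \<omega> show "balls (losing_bin \<omega>) (\<omega> m) =
      (if losing_bin \<omega> = Bin1 then fst (\<omega> m) else snd (\<omega> m))"
      by (cases "losing_bin \<omega>") auto
  qed
  moreover have "(\<lambda>\<omega>. fst (\<omega> m)) \<in> measurable (bb_process f u) (count_space UNIV)"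
    and "(\<lambda>\<omega>. snd (\<omega> m)) \<in> measurable (bb_process f u) (count_space UNIV)"
    using measurable_bb_state[of m] by (rule measurable_compose; simp)+
  moreover have "Measurable.pred (bb_process f u) (\<lambda>\<omega>. losing_bin \<omega> = Bin1)"
    by (rule measurable_compose[OF measurable_losing_bin]) simp
  ultimately show ?thesis by simp
qed

lemma measurable_losing_number [measurable]:
  "losing_number \<in> measurable (bb_process f u) (count_space UNIV)"
proof -
  define L where "L = (\<lambda>\<omega> m. balls (losing_bin \<omega>) (\<omega> m))"
  have [measurable]: "(\<lambda>\<omega>. L \<omega> m) \<in> measurable (bb_process f u) (count_space UNIV)" for m
    unfolding L_def by (rule measurable_losing_count)
  have L: "X \<longlonglongrightarrow> l \<longleftrightarrow> (\<exists>N. \<forall>m\<ge>N. X m = l)" for X and l :: nat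
    by (simp add: tendsto_discrete eventually_sequentially)
  have eq: "losing_number = (\<lambda>\<omega>. if \<exists>l N. \<forall>m\<ge>N. L \<omega> m = l
      then (LEAST l. \<exists>N. \<forall>m\<ge>N. L \<omega> m = l) else (THE l::nat. False))"
  proof
    fix \<omega>
    have nm: "losing_number \<omega> = (THE l. \<exists>N. \<forall>m\<ge>N. L \<omega> m = l)"
      by (simp add: losing_number_def lim_def L_def L)
    show "losing_number \<omega> = (if \<exists>l N. \<forall>m\<ge>N. L \<omega> m = l
      then (LEAST l. \<exists>N. \<forall>m\<ge>N. L \<omega> m = l) else (THE l::nat. False))"
    proof (cases "\<exists>l N. \<forall>m\<ge>N. L \<omega> m = l")
      case True
      then obtain l where l: "\<exists>N. \<forall>m\<ge>N. L \<omega> m = l" by auto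
      have uniq: "l' = l" if "\<exists>N. \<forall>m\<ge>N. L \<omega> m = l'" for l'
        using l that by (metis nat_le_linear)
      have "(THE l. \<exists>N. \<forall>m\<ge>N. L \<omega> m = l) = l" by (rule the_equality[where P="\<lambda>l. \<exists>N. \<forall>m\<ge>N. L \<omega> m = l", OF l uniq])
      moreover have "(LEAST l. \<exists>N. \<forall>m\<ge>N. L \<omega> m = l) = l"
        using LeastI[where P="\<lambda>l. \<exists>N. \<forall>m\<ge>N. L \<omega> m = l", OF l] by (rule uniq)
      ultimately show ?thesis using True nm by simp
    next
      case False
      then have "(\<lambda>l. \<exists>N. \<forall>m\<ge>N. L \<omega> m = l) = (\<lambda>_. False)" by (simp only: fun_eq_iff) blast
      then show ?thesis using False nm by simp
    qed
  qed
  show ?thesis unfolding eq by measurable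
qed

lemma measurable_loser_has_more_than [measurable]:
  "Measurable.pred (bb_process f u) (loser_has_more_than \<alpha> n)"
  unfolding loser_has_more_than_def[abs_def] by simp

end

end

theory Submission
  imports Defs
begin

text \<open>
  Let \<open>V k l\<close> be the probability that the process visits \<open>(k, l)\<close> and put
  \<open>G k l = V k l * f k * f l / (f k + f l)\<close>. The forward equation for \<open>V\<close> says that \<open>G k l\<close> is the
  average of \<open>G (k - 1) l\<close> and \<open>G k (l - 1)\<close> with weights proportional to \<open>f k\<close> and \<open>f l\<close>. The function
  \<open>f k * (G k l - G (k - 1) l)\<close> satisfies the same equation, hence is bounded by the maximum
  principle, and since \<open>1 / f\<close> is summable, \<open>G k l\<close> converges to some \<open>\<gamma>\<close> as \<open>k\<close> and \<open>l\<close> tend to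
  infinity. Comparison with a quadratic subharmonic function of \<open>k - l\<close> gives \<open>\<gamma> > 0\<close>.

  The losing number exceeds \<open>n\<close> iff both bins do so eventually, which happens by a last step from
  \<open>(n, l)\<close> or \<open>(l, n)\<close> with \<open>l > n\<close>; its probability is the sum of \<open>(G n l + G l n) / f l\<close>, so
  \<open>c = 2 * \<gamma>\<close>. When there are \<open>n\<close> balls, both bins hold at least \<open>\<alpha> * n\<close> with probability the sum
  of \<open>V k (n - k)\<close> over \<open>\<alpha> * n \<le> k \<le> (1 - \<alpha>) * n\<close>, and \<open>V k (n - k)\<close> is about
  \<open>\<gamma> * (1 / f k + 1 / f (n - k))\<close>. Otherwise the loser is far ahead and the winner must catch up at
  some \<open>(j, j)\<close> with \<open>2 * j > n\<close>; the same quadratic comparison shows that this costs another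
  factor of order \<open>1 / n\<close>.
\<close>

section \<open>Functions harmonic for the reversed chain\<close>

text \<open>\<open>f_superlinear\<close> is monotonicity of \<open>f k / k\<close> in division-free
  form. \<open>f_0\<close> makes the weighted differences used below vanish on the axes in spite of
  truncated subtraction.\<close>

locale feedback =
  fixes f :: "nat \<Rightarrow> real"
  assumes f_pos: "0 < n \<Longrightarrow> 0 < f n"
    and f_0: "f 0 = 0"
    and f_superlinear: "l \<le> k \<Longrightarrow> f l * real k \<le> f k * real l"
    and summable_f: "summable (\<lambda>n. 1 / f n)"
begin

lemma f_nonneg: "0 \<le> f n"
  using f_pos[of n] f_0 by (cases n) auto

text \<open>
  Harmonic above level \<open>N\<close> for the chain that takes balls out, removing one from the first bin with
  probability \<open>f k / (f k + f l)\<close>.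
\<close>

definition harmonic :: "nat \<Rightarrow> (nat \<Rightarrow> nat \<Rightarrow> real) \<Rightarrow> bool" where
  "harmonic N G \<longleftrightarrow>
     (\<forall>k l. N < Suc k + Suc l \<longrightarrow>
        (f (Suc k) + f (Suc l)) * G (Suc k) (Suc l) =
        f (Suc k) * G k (Suc l) + f (Suc l) * G (Suc k) l) \<and>
     (\<forall>k. G k 0 = 0 \<and> G 0 k = 0)"

lemma harmonicD:
  "harmonic N G \<Longrightarrow> N < Suc k + Suc l \<Longrightarrow>
     (f (Suc k) + f (Suc l)) * G (Suc k) (Suc l) =
     f (Suc k) * G k (Suc l) + f (Suc l) * G (Suc k) l"
  unfolding harmonic_def by blast

lemma harmonic_bdry: "harmonic N G \<Longrightarrow> G k 0 = 0" "harmonic N G \<Longrightarrow> G 0 k = 0"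
  unfolding harmonic_def by blast+

section \<open>Comparison with superharmonic functions\<close>

lemma harmonic_mono: "harmonic N G \<Longrightarrow> N \<le> N' \<Longrightarrow> harmonic N' G"
  unfolding harmonic_def by (meson le_less_trans)

lemma harmonic_uminus:
  assumes "harmonic N G"
  shows "harmonic N (\<lambda>k l. - G k l)"
  unfolding harmonic_def
proof (intro allI conjI impI)
  fix k l assume "N < Suc k + Suc l"
  from harmonicD[OF assms this]
  show "(f (Suc k) + f (Suc l)) * - G (Suc k) (Suc l) = f (Suc k) * - G k (Suc l) + f (Suc l) * - G (Suc k) l"
    by linarith
qed (use harmonic_bdry[OF assms] in simp_all)

text \<open>Maximum principle, by induction on \<open>k + l\<close>: inside the quadrant
  \<open>G\<close> equals, and \<open>Q\<close> dominates, a weighted average over the two sites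
  with one ball less. A barrier thus has to be checked only on level \<open>N\<close> and on the
  axes.\<close>

lemma harmonic_le:
  assumes G: "harmonic N G"
    and Q: "\<And>k l. N < Suc k + Suc l \<Longrightarrow>
        f (Suc k) * Q k (Suc l) + f (Suc l) * Q (Suc k) l
        \<le> (f (Suc k) + f (Suc l)) * Q (Suc k) (Suc l)"
    and level: "\<And>k l. k + l = N \<Longrightarrow> G k l \<le> Q k l"
    and bdry: "\<And>k. N \<le> k \<Longrightarrow> 0 \<le> Q k 0" "\<And>k. N \<le> k \<Longrightarrow> 0 \<le> Q 0 k"
  shows "N \<le> k + l \<Longrightarrow> G k l \<le> Q k l"
proof (induction "k + l" arbitrary: k l rule: less_induct)
  case less
  show ?case
  proof (cases "k = 0 \<or> l = 0 \<or> k + l = N")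
    case True
    then show ?thesis using less.prems level bdry harmonic_bdry[OF G] by auto
  next
    case False
    then obtain i j where ij: "k = Suc i" "l = Suc j" by (metis not0_implies_Suc)
    have lt: "N < Suc i + Suc j" using False less.prems ij by auto
    have 1: "G i (Suc j) \<le> Q i (Suc j)" "G (Suc i) j \<le> Q (Suc i) j"
      using less.hyps ij lt by simp_all
    have pos: "0 < f (Suc i)" "0 < f (Suc j)" by (simp_all add: f_pos)
    have "(f (Suc i) + f (Suc j)) * G (Suc i) (Suc j) \<le> (f (Suc i) + f (Suc j)) * Q (Suc i) (Suc j)"
      using harmonicD[OF G lt] Q[OF lt] pos
        mult_left_mono[OF 1(1), of "f (Suc i)"] mult_left_mono[OF 1(2), of "f (Suc j)"] by linarith
    then show ?thesis using pos ij by simp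
  qed
qed

text \<open>Nonnegative constants are barriers, so the sum of the finitely many absolute values on
  level \<open>N\<close> bounds everything above; negation gives the other sign.\<close>

lemma harmonic_bounded:
  assumes G: "harmonic N G"
  obtains B where "0 \<le> B" "\<And>k l. N \<le> k + l \<Longrightarrow> \<bar>G k l\<bar> \<le> B"
proof -
  define B where "B = (\<Sum>k\<le>N. \<bar>G k (N - k)\<bar>)"
  have B0: "0 \<le> B" unfolding B_def by (simp add: sum_nonneg)
  have lev: "\<bar>G k l\<bar> \<le> B" if "k + l = N" for k l
    using member_le_sum[of k "{..N}" "\<lambda>k. \<bar>G k (N - k)\<bar>"] that unfolding B_def by auto
  have up: "G' k l \<le> B" if "harmonic N G'" "\<And>k l. k + l = N \<Longrightarrow> G' k l \<le> B" "N \<le> k + l" for G' k l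
    using harmonic_le[OF that(1), where Q = "\<lambda>_ _. B"] that(2,3) B0 by (simp add: algebra_simps)
  show ?thesis
  proof
    show "\<bar>G k l\<bar> \<le> B" if "N \<le> k + l" for k l
      using up[OF G _ that] up[OF harmonic_uminus[OF G] _ that] lev
      by (metis abs_le_iff)
  qed (fact B0)
qed

text \<open>The difference operators in the two variables commute, so each of them preserves harmonicity.\<close>

lemma harmonic_diff:
  assumes G: "harmonic N G"
  shows "harmonic (Suc N) (\<lambda>k l. f k * (G k l - G (k - 1) l))"
proof -
  have "(f (Suc k) + f (Suc l)) * (f (Suc k) * (G (Suc k) (Suc l) - G k (Suc l))) =
     f (Suc k) * (f k * (G k (Suc l) - G (k - 1) (Suc l))) +
     f (Suc l) * (f (Suc k) * (G (Suc k) l - G k l))"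
    if N: "Suc N < Suc k + Suc l" for k l
  proof -
    have h1: "(f (Suc k) + f (Suc l)) * G (Suc k) (Suc l) =
        f (Suc k) * G k (Suc l) + f (Suc l) * G (Suc k) l"
      using harmonicD[OF G, of k l] N by simp
    \<comment> \<open>The equation one level lower enters as well, hence \<open>Suc N\<close>. For
      \<open>k = 0\<close> it reads \<open>0 = 0\<close> by \<open>f_0\<close> and the boundary
      values.\<close>
    have "(f k + f (Suc l)) * G k (Suc l) = f k * G (k - 1) (Suc l) + f (Suc l) * G k l"
    proof (cases k)
      case 0
      then show ?thesis using harmonic_bdry[OF G] by (simp add: f_0)
    next
      case (Suc i)
      then show ?thesis using harmonicD[OF G, of i l] N by simp
    qed
    with h1 show ?thesis by algebra
  qed
  moreover have "f k * (G k 0 - G (k - 1) 0) = 0" "f 0 * (G 0 l - G (0 - 1) l) = 0" for k l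
    using harmonic_bdry(1)[OF G] by (simp_all add: f_0)
  ultimately show ?thesis unfolding harmonic_def diff_Suc_1 by blast
qed

section \<open>Tails of the reciprocal series and limits of harmonic functions\<close>

definition tail :: "nat \<Rightarrow> real" where
  "tail n = (\<Sum>j. 1 / f (n + j))"

lemma summable_shift: "summable (\<lambda>j. 1 / f (n + j))"
  using summable_ignore_initial_segment[OF summable_f, of n] by (simp add: add.commute)

lemma tail_nonneg: "0 \<le> tail n"
  unfolding tail_def by (intro suminf_nonneg summable_shift) (simp add: f_nonneg)

lemma tail_Suc: "tail n = 1 / f n + tail (Suc n)"
  using suminf_split_head[OF summable_shift[of n]]
  unfolding tail_def add_Suc_right add_Suc add_0_right by linarith

lemma tail_antimono: "m \<le> n \<Longrightarrow> tail n \<le> tail m"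
proof (rule lift_Suc_antimono_le)
  show "tail (Suc n) \<le> tail n" for n
    using tail_Suc[of n] f_nonneg[of n] by simp
qed

lemma tail_tendsto_0: "tail \<longlonglongrightarrow> 0"
proof -
  have "tail = (\<lambda>n. \<Sum>k. 1 / f (k + n))"
    by (simp add: tail_def fun_eq_iff add.commute)
  then show ?thesis using suminf_exist_split2[OF summable_f] by simp
qed

lemma sum_tail: "m \<le> n \<Longrightarrow> (\<Sum>j\<in>{m..<n}. 1 / f j) = tail m - tail n"
proof (induction n rule: dec_induct)
  case (step n)
  then show ?case using tail_Suc[of n] by simp
qed simp

text \<open>\<open>harmonic_diff\<close> and the maximum principle bound one-ball increments of
  \<open>G\<close> by a constant over \<open>f\<close>. Telescoping turns this into tails, so the
  diagonal is Cauchy, and every other site is compared with it. The explicit error allows summation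
  over sites later.\<close>

lemma harmonic_tendsto:
  assumes G: "harmonic N G"
  obtains \<gamma> C where "0 \<le> C"
    "\<And>k l. N \<le> k + l \<Longrightarrow> \<bar>G k l - \<gamma>\<bar> \<le> C * (tail (Suc k) + tail (Suc l))"
proof -
  obtain C where C: "0 \<le> C"
    and D: "\<And>k l. Suc N \<le> k + l \<Longrightarrow> \<bar>f k * (G k l - G (k - 1) l)\<bar> \<le> C"
    using harmonic_bounded[OF harmonic_diff[OF G]] by blast
  have step: "\<bar>d\<bar> \<le> C * (1 / f (Suc k))" if "\<bar>f (Suc k) * d\<bar> \<le> C" for d k
    using that f_pos[of "Suc k"] by (simp add: abs_mult field_simps)
  have D1: "\<bar>G (Suc k) l - G k l\<bar> \<le> C * (1 / f (Suc k))" if "N \<le> k + l" for k l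
    using D[of "Suc k" l] that by (intro step) simp
  \<comment> \<open>Harmonicity makes the weighted increment in \<open>l\<close> the negative of the
    one in \<open>k\<close>, so the same constant serves.\<close>
  have D2: "\<bar>G k (Suc l) - G k l\<bar> \<le> C * (1 / f (Suc l))" if "N \<le> k + l" for k l
  proof (cases k)
    case 0
    then show ?thesis using harmonic_bdry[OF G] C f_nonneg by simp
  next
    case (Suc i)
    have "f (Suc l) * (G k (Suc l) - G k l) = - (f k * (G k (Suc l) - G (k - 1) (Suc l)))"
      using harmonicD[OF G, of i l] Suc that by (simp add: algebra_simps)
    with D[of k "Suc l"] that show ?thesis by (intro step) simp
  qed
  have T1: "\<bar>G k' l - G k l\<bar> \<le> C * (tail (Suc k) - tail (Suc k'))" if "k \<le> k'" "N \<le> k + l" for k k' l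
    using that(1)
  proof (induction k' rule: dec_induct)
    case (step n)
    have "C * (tail (Suc k) - tail (Suc (Suc n))) =
          C * (tail (Suc k) - tail (Suc n)) + C * (1 / f (Suc n))"
      using tail_Suc[of "Suc n"] by (simp add: algebra_simps)
    with step D1[of n l] that(2) show ?case by linarith
  qed simp
  have T2: "\<bar>G k l' - G k l\<bar> \<le> C * (tail (Suc l) - tail (Suc l'))" if "l \<le> l'" "N \<le> k + l" for k l l'
    using that(1)
  proof (induction l' rule: dec_induct)
    case (step n)
    have "C * (tail (Suc l) - tail (Suc (Suc n))) =
          C * (tail (Suc l) - tail (Suc n)) + C * (1 / f (Suc n))"
      using tail_Suc[of "Suc n"] by (simp add: algebra_simps)
    with step D2[of k n] that(2) show ?case by linarith
  qed simp
  have T: "\<bar>G m m - G k l\<bar> \<le> C * (tail (Suc k) + tail (Suc l))"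
    if "k \<le> m" "l \<le> m" "N \<le> k + l" for k l m
  proof -
    have "\<bar>G m m - G k l\<bar> \<le> C * (tail (Suc k) - tail (Suc m)) + C * (tail (Suc l) - tail (Suc m))"
      using T1[of k m l] T2[of l m m] that by linarith
    also have "\<dots> \<le> C * tail (Suc k) + C * tail (Suc l)"
      using C tail_nonneg by (intro add_mono mult_left_mono) auto
    finally show ?thesis by (simp add: algebra_simps)
  qed
  have "Cauchy (\<lambda>m. G m m)"
  proof (rule CauchyI')
    fix e :: real assume e: "0 < e"
    have "(\<lambda>k. C * (tail (Suc k) + tail (Suc k))) \<longlonglongrightarrow> C * (0 + 0)"
      by (intro tendsto_intros LIMSEQ_Suc tail_tendsto_0)
    then have "\<forall>\<^sub>F k in sequentially. C * (tail (Suc k) + tail (Suc k)) < e"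
      using e by (intro order_tendstoD) auto
    then obtain K where K: "\<And>k. k \<ge> K \<Longrightarrow> C * (tail (Suc k) + tail (Suc k)) < e"
      by (auto simp: eventually_sequentially)
    have "dist (G m m) (G n n) < e" if "max K N \<le> m" "m < n" for m n
      using T[of m n m] K[of m] that by (simp add: dist_real_def abs_minus_commute)
    then show "\<exists>M. \<forall>m\<ge>M. \<forall>n>m. dist (G m m) (G n n) < e" by blast
  qed
  then obtain \<gamma> where g: "(\<lambda>m. G m m) \<longlonglongrightarrow> \<gamma>"
    using Cauchy_convergent_iff convergent_def by blast
  have "\<bar>G k l - \<gamma>\<bar> \<le> C * (tail (Suc k) + tail (Suc l))" if "N \<le> k + l" for k l
  proof (rule LIMSEQ_le_const2)
    show "(\<lambda>m. \<bar>G k l - G m m\<bar>) \<longlonglongrightarrow> \<bar>G k l - \<gamma>\<bar>" by (intro tendsto_intros g)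
    show "\<exists>M. \<forall>m\<ge>M. \<bar>G k l - G m m\<bar> \<le> C * (tail (Suc k) + tail (Suc l))"
      using T[of k _ l] that by (intro exI[of _ "max k l"]) (auto simp: abs_minus_commute)
  qed
  then show ?thesis by (rule that[OF C])
qed

text \<open>
  With \<open>s = k + l\<close> and \<open>d = k - l\<close>, superlinearity of \<open>f\<close> makes the chain that takes balls out
  self-balancing: one step turns \<open>d\<^sup>2\<close> into at most \<open>d\<^sup>2 * (1 - 2 / s) + 1\<close> in expectation.
  The function \<open>(d\<^sup>2 / s - 1) / (s - 1)\<close> exactly absorbs this bound.
\<close>

definition imbalance :: "nat \<Rightarrow> nat \<Rightarrow> real" where
  "imbalance k l = ((real k - real l)\<^sup>2 - real (k + l)) / (real (k + l) * (real (k + l) - 1))"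

lemma imbalance_eqs: 
  fixes s d :: real
  assumes "s = real (Suc k + Suc l)" "d = real k - real l"
  shows "imbalance k (Suc l) = ((d - 1)\<^sup>2 - (s - 1)) / ((s - 1) * (s - 2))"
    and "imbalance (Suc k) l = ((d + 1)\<^sup>2 - (s - 1))/ ((s - 1) * (s - 2))"
    and "imbalance (Suc k) (Suc l) = (d\<^sup>2 - s) / (s * (s - 1))"
proof -
  have 1: "real (k + Suc l) = s - 1" "real (Suc k + l) = s - 1" "real (Suc k + Suc l) = s"
     "real k - real (Suc l) = d - 1" "real (Suc k) - real l = d + 1" "real (Suc k) - real (Suc l) = d"
    using assms by simp_all
  show "imbalance k (Suc l) = ((d - 1)\<^sup>2 - (s - 1)) / ((s - 1) * (s - 2))"
    and "imbalance (Suc k) l = ((d + 1)\<^sup>2 - (s - 1))/ ((s - 1) * (s - 2))"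
    and "imbalance (Suc k) (Suc l) = (d\<^sup>2 - s) / (s * (s - 1))"
    unfolding imbalance_def 1 by simp_all
qed

text \<open>Over a common denominator the slack has numerator
  \<open>2 * (d * (s * (a - b) - d * (a + b)))\<close>. The bracket equals
  \<open>2 * (Suc l * a - Suc k * b)\<close>, which has the sign of \<open>d\<close> because
  \<open>f k / k\<close> is nondecreasing.\<close>

lemma imbalance_superharmonic:
  assumes "2 < Suc k + Suc l"
  shows "f (Suc k) * imbalance k (Suc l) + f (Suc l) * imbalance (Suc k) l
         \<le> (f (Suc k) + f (Suc l)) * imbalance (Suc k) (Suc l)"
proof -
  define a where "a = f (Suc k)"
  define b where "b = f (Suc l)"
  define s where "s = real (Suc k + Suc l)"
  define d where "d = real k - real l"
  note defs = a_def b_def s_def d_def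
  have s: "2 < s"
    unfolding s_def using assms by (metis of_nat_less_iff of_nat_numeral)
  have "0 \<le> d * (2 * (real (Suc l) * a - real (Suc k) * b))"
  proof (cases "l \<le> k")
    case True
    then show ?thesis using f_superlinear[of "Suc l" "Suc k"]
      by (intro mult_nonneg_nonneg) (auto simp: defs algebra_simps)
  next
    case False
    then show ?thesis using f_superlinear[of "Suc k" "Suc l"]
      by (intro mult_nonpos_nonpos) (auto simp: defs algebra_simps)
  qed
  also have "2 * (real (Suc l) * a - real (Suc k) * b) = s * (a - b) - d * (a + b)"
    by (simp add: defs algebra_simps)
  finally have key: "0 \<le> d * (s * (a - b) - d * (a + b))" .
  define P where "P = (d - 1)\<^sup>2 - (s - 1)"
  define Q where "Q = (d + 1)\<^sup>2 - (s - 1)"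
  note PQ = P_def Q_def
  have "(s - 2) * ((a + b) * (d\<^sup>2 - s)) - s * (a * P + b * Q) = 2 * (d * (s * (a - b) - d * (a + b)))"
    unfolding PQ by (simp add: power2_eq_square algebra_simps)
  with key have poly: "s * (a * P + b * Q) \<le> (s - 2) * ((a + b) * (d\<^sup>2 - s))" by linarith
  have "a * (P / ((s - 1) * (s - 2))) + b * (Q / ((s - 1) * (s - 2))) =
      s * (a * P + b * Q) / (s * ((s - 1) * (s - 2)))"
    using s by (simp add: add_divide_distrib)
  also have "\<dots> \<le> (s - 2) * ((a + b) * (d\<^sup>2 - s)) / (s * ((s - 1) * (s - 2)))"
    using s by (intro divide_right_mono poly) simp
  also have "\<dots> = (a + b) * ((d\<^sup>2 - s) / (s * (s - 1)))"
    using s by simp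
  finally have "a * (P / ((s - 1) * (s - 2))) + b * (Q / ((s - 1) * (s - 2)))
    \<le> (a + b) * ((d\<^sup>2 - s) / (s * (s - 1)))" .
  moreover note imbalance_eqs[OF s_def d_def, folded P_def Q_def]
  ultimately show ?thesis by (simp only: defs)
qed

lemma imbalance_bdry: "2 \<le> k \<Longrightarrow> imbalance k 0 = 1" "2 \<le> k \<Longrightarrow> imbalance 0 k = 1"
  by (simp_all add: imbalance_def power2_eq_square algebra_simps)

text \<open>Constants satisfy the averaging equation exactly. Both barriers below have this affine
  form.\<close>

lemma imbalance_superharmonic_affine:
  assumes "0 \<le> e" "2 < Suc k + Suc l"
  shows "f (Suc k) * (e * (imbalance k (Suc l) + c)) + f (Suc l) * (e * (imbalance (Suc k) l + c))
         \<le> (f (Suc k) + f (Suc l)) * (e * (imbalance (Suc k) (Suc l) + c))"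
  using mult_left_mono[OF imbalance_superharmonic[OF assms(2)] assms(1)]
  by (simp add: algebra_simps)

text \<open>\<open>- G\<close> is compared with \<open>\<epsilon> * (imbalance k l - 1 / 2)\<close>.
  On a high level this barrier is nonnegative near the axes, where \<open>G\<close> may vanish, and
  at least \<open>- \<epsilon>\<close> elsewhere, where \<open>G\<close> is at least
  \<open>\<epsilon>\<close>. On the diagonal it is at most \<open>- \<epsilon> / 2\<close>, which
  keeps \<open>G m m\<close> away from zero.\<close>

lemma harmonic_limit_pos:
  assumes G: "harmonic (x + y) G" and nonneg: "\<And>k l. 0 \<le> G k l"
    and start: "0 < G x y" and xy: "0 < x" "0 < y"
    and conv: "(\<lambda>m. G m m) \<longlonglongrightarrow> \<gamma>"
  shows "0 < \<gamma>"
proof -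
  have pos: "x \<le> k \<Longrightarrow> y \<le> l \<Longrightarrow> 0 < G k l" for k l
  proof (induction "k + l" arbitrary: k l rule: less_induct)
    case less
    show ?case
    proof (cases "k = x \<and> l = y")
      case True
      then show ?thesis using start by simp
    next
      case False
      obtain i j where ij: "k = Suc i" "l = Suc j" using less.prems xy by (metis Suc_le_D Suc_le_eq)
      have "x \<le> i \<or> y \<le> j" using False less.prems ij by auto
      then have "0 < G i l \<or> 0 < G k j" using less.hyps[of i l] less.hyps[of k j] less.prems ij by auto
      then have "0 < f (Suc i) * G i (Suc j) + f (Suc j) * G (Suc i) j"
        using f_pos[of k] f_pos[of l] ij nonneg
        by (auto intro: add_pos_nonneg add_nonneg_pos)
      also have "\<dots> = (f (Suc i) + f (Suc j)) * G (Suc i) (Suc j)"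
        using harmonicD[OF G, of i j] False less.prems ij by auto
      finally show ?thesis using ij f_nonneg
        by (metis add_nonneg_nonneg linorder_not_less mult_nonneg_nonpos)
    qed
  qed
  define X where "X = max x y"
  \<comment> \<open>Large enough that a site of level \<open>N\<close> with a coordinate at most
    \<open>X\<close> has \<open>|k - l|\<close> at least \<open>6 * X + 8\<close>, which forces
    \<open>imbalance\<close> to be at least \<open>1 / 2\<close>.\<close>
  define N where "N = 8 * X + 8"
  define \<epsilon> where "\<epsilon> = Min ((\<lambda>k. G k (N - k)) ` {x..N - y})"
  have NX: "x + y \<le> N" "2 \<le> N" "x \<le> N - y" by (auto simp: N_def X_def)
  have fin: "finite ((\<lambda>k. G k (N - k)) ` {x..N - y})" "((\<lambda>k. G k (N - k)) ` {x..N - y}) \<noteq> {}"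
    using NX by auto
  have eps: "0 < \<epsilon>" unfolding \<epsilon>_def using fin pos NX by (subst Min_gr_iff) auto
  have lev: "- G k l \<le> \<epsilon> * (imbalance k l + - (1 / 2))" if kl: "k + l = N" for k l
  proof (cases "x \<le> k \<and> y \<le> l")
    case True
    have k: "k \<in> {x..N - y}" "l = N - k" using True kl by auto
    have "\<epsilon> \<le> G k l" unfolding \<epsilon>_def using fin k by (intro Min_le) auto
    moreover have "\<epsilon> * (- 1) \<le> \<epsilon> * (imbalance k l + - (1 / 2))"
    proof (rule mult_left_mono)
      have "- (real N / (real N * (real N - 1))) \<le> imbalance k l"
        using NX kl unfolding imbalance_def kl minus_divide_left
        by (intro divide_right_mono) auto
      moreover have "real N / (real N * (real N - 1)) = 1 / (real N - 1)"
        using NX by simp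
      moreover have "1 / (real N - 1) \<le> 1 / 2"
        by (simp add: N_def field_simps)
      ultimately show "- 1 \<le> imbalance k l + - (1 / 2)" by linarith
    qed (use eps in simp)
    ultimately show ?thesis by simp
  next
    case False
    then have kl': "k \<le> X \<or> l \<le> X" by (auto simp: X_def)
    have "real N - 2 * real X \<le> \<bar>real k - real l\<bar>"
      using kl kl' by (auto simp: N_def)
    then have "(real N - 2 * real X)\<^sup>2 \<le> \<bar>real k - real l\<bar>\<^sup>2"
      by (intro power_mono) (auto simp: N_def)
    moreover have "real N * (real N - 1) \<le> 2 * ((real N - 2 * real X)\<^sup>2 - real N)"
      by (simp add: N_def power2_eq_square algebra_simps)
    ultimately have "1 / 2 \<le> imbalance k l"
      unfolding imbalance_def kl using NX by (simp add: field_simps power2_abs)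
    then show ?thesis using eps nonneg[of k l] by (smt (verit) mult_nonneg_nonneg)
  qed
  have "- G k l \<le> \<epsilon> * (imbalance k l + - (1 / 2))" if "N \<le> k + l" for k l
  proof (rule harmonic_le[OF harmonic_uminus[OF harmonic_mono[OF G NX(1)]] _ lev _ _ that])
    show "f (Suc k) * (\<epsilon> * (imbalance k (Suc l) + - (1 / 2))) + f (Suc l) * (\<epsilon> * (imbalance (Suc k) l + - (1 / 2)))
      \<le> (f (Suc k) + f (Suc l)) * (\<epsilon> * (imbalance (Suc k) (Suc l) + - (1 / 2)))"
      if "N < Suc k + Suc l" for k l
      using that eps NX by (intro imbalance_superharmonic_affine) auto
  qed (use imbalance_bdry NX eps in auto)
  note low = this
  have "\<epsilon> / 2 \<le> G m m" if "N \<le> m" for m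
  proof -
    have "imbalance m m \<le> 0" by (cases m) (auto simp: imbalance_def divide_nonpos_nonneg)
    then have "\<epsilon> * (imbalance m m + - (1 / 2)) \<le> \<epsilon> * (- (1 / 2))" using eps by (intro mult_left_mono) auto
    then show ?thesis using low[of m m] that by simp
  qed
  then have "\<epsilon> / 2 \<le> \<gamma>" using conv by (intro LIMSEQ_le_const) blast+
  then show ?thesis using eps by simp
qed

text \<open>Chebyshev's inequality for the ball-removing chain started at \<open>(j, j)\<close>: on
  level \<open>n\<close> the square of \<open>k - l\<close> has mean at most \<open>n\<close>, while
  only sites with \<open>|k - l|\<close> at least \<open>\<delta> * n\<close> contribute
  positively.\<close>

lemma harmonic_unbalanced_le:
  assumes G: "harmonic n G" and n: "2 \<le> n" and \<delta>: "0 < \<delta>" and M: "0 \<le> M"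
    and level: "\<And>k l. k + l = n \<Longrightarrow> G k l \<le> M"
      "\<And>k l. k + l = n \<Longrightarrow> \<bar>real k - real l\<bar> < \<delta> * real n \<Longrightarrow> G k l \<le> 0"
    and j: "n \<le> 2 * j"
  shows "G j j \<le> M / (\<delta>\<^sup>2 * real n)"
proof -
  \<comment> \<open>On level \<open>n\<close>, \<open>imbalance k l + c\<close> is the square of
    \<open>k - l\<close> over \<open>n * (n - 1)\<close>; the factor \<open>e\<close> makes the
    barrier equal to \<open>M\<close> at \<open>|k - l| = \<delta> * n\<close>.\<close>
  define e where "e = M * (real n - 1) / (\<delta>\<^sup>2 * real n)"
  define c where "c = 1 / (real n - 1)"
  have e: "0 \<le> e" using M n by (simp add: e_def)
  have "G k l \<le> e * (imbalance k l + c)" if kl: "k + l = n" for k l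
  proof -
    have im: "imbalance k l + c = (real k - real l)\<^sup>2 / (real n * (real n - 1))"
    proof -
      have "c = real n / (real n * (real n - 1))" using n by (simp add: c_def)
      then show ?thesis unfolding imbalance_def kl by (simp add: diff_divide_distrib)
    qed
    show ?thesis
    proof (cases "\<bar>real k - real l\<bar> < \<delta> * real n")
      case True
      have "0 \<le> e * (imbalance k l + c)" unfolding im using e n by simp
      then show ?thesis using level(2)[OF kl True] by simp
    next
      case False
      then have "(\<delta> * real n)\<^sup>2 \<le> (real k - real l)\<^sup>2"
        using \<delta> n by (subst abs_le_square_iff[symmetric]) simp
      then have "M * ((\<delta> * real n)\<^sup>2 / (\<delta>\<^sup>2 * (real n)\<^sup>2)) \<le> M * ((real k - real l)\<^sup>2 / (\<delta>\<^sup>2 * (real n)\<^sup>2))"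
        using M by (intro mult_left_mono divide_right_mono) auto
      also have "\<dots> = e * (imbalance k l + c)"
        unfolding im e_def using n \<delta> by (simp add: divide_simps) (simp add: power2_eq_square)
      finally show ?thesis using level(1)[OF kl] \<delta> n by (simp add: power_mult_distrib)
    qed
  qed
  note lev = this
  have "G j j \<le> e * (imbalance j j + c)"
  proof (rule harmonic_le[OF G _ lev])
    show "f (Suc k) * (e * (imbalance k (Suc l) + c)) + f (Suc l) * (e * (imbalance (Suc k) l + c))
      \<le> (f (Suc k) + f (Suc l)) * (e * (imbalance (Suc k) (Suc l) + c))"
      if "n < Suc k + Suc l" for k l
      using that e n by (intro imbalance_superharmonic_affine) auto
  qed (use imbalance_bdry n e j in \<open>auto simp: c_def\<close>)
  also have "\<dots> \<le> e * c"
  proof (rule mult_left_mono)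
    have "imbalance j j \<le> 0" by (cases j) (auto simp: imbalance_def divide_nonpos_nonneg)
    then show "imbalance j j + c \<le> c" by simp
  qed (fact e)
  also have "e * c = M / (\<delta>\<^sup>2 * real n)" using n by (simp add: e_def c_def)
  finally show ?thesis .
qed

end

section \<open>Trajectories\<close>

text \<open>States are countable, so an event decided by the times up to \<open>m\<close> is a
  countable union of cylinders.\<close>

lemma measurable_history_event:
  assumes Q: "\<And>\<omega> \<omega>'. (\<And>k. k \<le> m \<Longrightarrow> \<omega> k = \<omega>' k) \<Longrightarrow> Q \<omega> = Q \<omega>'"
  shows "{\<omega>. Q \<omega>} \<in> sets (bb_process f u)"
    and "{\<omega>. Q \<omega> \<and> \<omega> (Suc m) = t} \<in> sets (bb_process f u)"
proof -
  \<comment> \<open>Histories are lists because these form a countable type; \<open>hs ! k\<close>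
    is unspecified for \<open>k > m\<close>, but \<open>Q\<close> ignores those times.\<close>
  define J where "J = {hs. length hs = Suc m \<and> Q (\<lambda>k. hs ! k)}"
  have "{\<omega>. Q \<omega>} = (\<Union>hs\<in>J. {\<omega>. \<forall>k\<le>m. \<omega> k = hs ! k})" (is "_ = ?R")
  proof (intro equalityI subsetI)
    fix \<omega> assume "\<omega> \<in> {\<omega>. Q \<omega>}"
    then have "map \<omega> [0..<Suc m] \<in> J" using Q[of \<omega> "\<lambda>k. map \<omega> [0..<Suc m] ! k"]
      by (auto simp: J_def simp del: upt_Suc)
    moreover have "\<omega> \<in> {\<omega>'. \<forall>k\<le>m. \<omega>' k = map \<omega> [0..<Suc m] ! k}" by (auto simp del: upt_Suc)
    ultimately show "\<omega> \<in> ?R" by blast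
  next
    fix \<omega> assume "\<omega> \<in> ?R"
    then show "\<omega> \<in> {\<omega>. Q \<omega>}" using Q unfolding J_def by blast
  qed
  moreover have "{\<omega>. \<forall>k\<le>m. \<omega> k = hs ! k} \<in> sets (bb_process f u)" for hs
  proof -
    have "{\<omega> \<in> space (bb_process f u). \<forall>k\<le>m. \<omega> k = hs ! k} \<in> sets (bb_process f u)" by measurable
    then show ?thesis by simp
  qed
  then have "?R \<in> sets (bb_process f u)" by (intro sets.countable_UN') auto
  ultimately show Qs: "{\<omega>. Q \<omega>} \<in> sets (bb_process f u)" by simp
  have "{\<omega> \<in> space (bb_process f u). \<omega> (Suc m) = t} \<in> sets (bb_process f u)" by measurable
  from sets.Int[OF Qs this] show "{\<omega>. Q \<omega> \<and> \<omega> (Suc m) = t} \<in> sets (bb_process f u)"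
    by (simp add: Int_def)
qed

text \<open>\<open>bb_process_Markov\<close> speaks of full histories. Here the disjoint cylinders
  that make up \<open>Q\<close> are summed; as \<open>Q\<close> fixes the state at time
  \<open>m\<close>, they share one transition probability.\<close>

lemma bb_process_Markov_event:
  assumes Q: "\<And>\<omega> \<omega>'. (\<And>k. k \<le> m \<Longrightarrow> \<omega> k = \<omega>' k) \<Longrightarrow> Q \<omega> = Q \<omega>'"
    and s: "\<And>\<omega>. Q \<omega> \<Longrightarrow> \<omega> m = s"
  shows "measure (bb_process f u) {\<omega>. Q \<omega> \<and> \<omega> (Suc m) = t} =
         measure (bb_process f u) {\<omega>. Q \<omega>} * pmf (step_pmf f s) t"
proof -
  let ?M = "bb_process f u"
  interpret prob_space ?M by (rule prob_space_bb_process)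
  define J where "J = {hs. length hs = Suc m \<and> Q (\<lambda>k. hs ! k)}"
  define A where "A hs = {\<omega>. \<forall>k\<le>m. \<omega> k = hs ! k}" for hs :: "state list"
  define A' where "A' hs = {\<omega>. \<forall>k\<le>Suc m. \<omega> k = (hs @ [t]) ! k}" for hs :: "state list"
  have As: "A hs \<in> sets ?M" "A' hs \<in> sets ?M" for hs
    unfolding A_def A'_def by (rule measurable_history_event[of m] measurable_history_event[of "Suc m"]; simp)+
  have A'_eq: "A' hs = A hs \<inter> {\<omega>. \<omega> (Suc m) = t}" if "hs \<in> J" for hs
    using that unfolding A_def A'_def J_def by (auto simp: nth_append le_Suc_eq)
  have QA: "{\<omega>. Q \<omega>} = (\<Union>hs\<in>J. A hs)"
  proof (intro equalityI subsetI)
    fix \<omega> assume "\<omega> \<in> {\<omega>. Q \<omega>}"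
    then have "map \<omega> [0..<Suc m] \<in> J" using Q[of \<omega> "\<lambda>k. map \<omega> [0..<Suc m] ! k"]
      by (auto simp: J_def simp del: upt_Suc)
    moreover have "\<omega> \<in> A (map \<omega> [0..<Suc m])" by (auto simp: A_def simp del: upt_Suc)
    ultimately show "\<omega> \<in> (\<Union>hs\<in>J. A hs)" by blast
  next
    fix \<omega> assume "\<omega> \<in> (\<Union>hs\<in>J. A hs)"
    then show "\<omega> \<in> {\<omega>. Q \<omega>}" using Q unfolding J_def A_def by blast
  qed
  have QA': "{\<omega>. Q \<omega> \<and> \<omega> (Suc m) = t} = (\<Union>hs\<in>J. A' hs)"
    using QA A'_eq by auto
  have inj: "hs = hs'" if "hs \<in> J" "hs' \<in> J" "\<omega> \<in> A hs" "\<omega> \<in> A hs'" for hs hs' \<omega>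
    using that by (intro nth_equalityI) (auto simp: J_def A_def less_Suc_eq_le)
  have disj: "disjoint_family_on A J" "disjoint_family_on A' J"
    using inj A'_eq unfolding disjoint_family_on_def by blast+
  have one: "emeasure ?M (A' hs) = emeasure ?M (A hs) * ennreal (pmf (step_pmf f s) t)" if hs: "hs \<in> J" for hs
  proof -
    have len: "length hs = Suc m" using hs by (simp add: J_def)
    have "hs ! m = s" using hs s by (auto simp: J_def)
    moreover have "A hs = {\<omega>. \<forall>k\<le>m. \<omega> k = (hs @ [t]) ! k}"
      using len by (auto simp: A_def nth_append)
    ultimately have "measure ?M (A' hs) = measure ?M (A hs) * pmf (step_pmf f s) t"
      using bb_process_Markov[of f u m "\<lambda>k. (hs @ [t]) ! k"] len
      by (simp add: A'_def nth_append)
    then show ?thesis by (simp add: emeasure_eq_measure ennreal_mult)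
  qed
  have "emeasure ?M {\<omega>. Q \<omega> \<and> \<omega> (Suc m) = t} = (\<integral>\<^sup>+hs. emeasure ?M (A' hs) \<partial>count_space J)"
    unfolding QA' by (intro emeasure_UN_countable As disj) auto
  also have "\<dots> = (\<integral>\<^sup>+hs. emeasure ?M (A hs) * ennreal (pmf (step_pmf f s) t) \<partial>count_space J)"
    by (intro nn_integral_cong one) simp
  also have "\<dots> = (\<integral>\<^sup>+hs. emeasure ?M (A hs) \<partial>count_space J) * ennreal (pmf (step_pmf f s) t)"
    by (intro nn_integral_multc) simp
  also have "(\<integral>\<^sup>+hs. emeasure ?M (A hs) \<partial>count_space J) = emeasure ?M {\<omega>. Q \<omega>}"
    unfolding QA by (intro emeasure_UN_countable[symmetric] As disj) auto
  finally have "ennreal (measure ?M {\<omega>. Q \<omega> \<and> \<omega> (Suc m) = t}) =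
      ennreal (measure ?M {\<omega>. Q \<omega>} * pmf (step_pmf f s) t)"
    by (simp add: emeasure_eq_measure ennreal_mult)
  then show ?thesis by (subst (asm) ennreal_inj) auto
qed

definition valid :: "state \<Rightarrow> (nat \<Rightarrow> state) \<Rightarrow> bool" where
  "valid u \<omega> \<longleftrightarrow> \<omega> 0 = u \<and> (\<forall>m. \<exists>i. \<omega> (Suc m) = add_ball i (\<omega> m))"

lemma set_pmf_step: "set_pmf (step_pmf f s) \<subseteq> range (\<lambda>i. add_ball i s)"
  unfolding step_pmf_def by auto

text \<open>The measure lives on arbitrary sequences of states. By the Markov property, a pair of
  states that no single ball connects occurs consecutively with probability zero, and there are
  countably many pairs.\<close>

lemma AE_valid: "AE \<omega> in bb_process f u. valid u \<omega>"
proof -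
  let ?M = "bb_process f u"
  interpret prob_space ?M by (rule prob_space_bb_process)
  have sets: "{\<omega>. P \<omega>} \<in> sets ?M" if "Measurable.pred ?M P" for P
    using that by (simp add: pred_def)
  have "AE \<omega> in ?M. \<omega> 0 = u"
    using bb_process_initial[of f u] by (intro AE_prob_1[of "{\<omega>. \<omega> 0 = u}", simplified]) simp
  moreover have "AE \<omega> in ?M. \<forall>m. \<exists>i. \<omega> (Suc m) = add_ball i (\<omega> m)"
  proof (subst AE_all_countable, intro allI)
    fix m
    have "AE \<omega> in ?M. \<forall>s t. t \<notin> range (\<lambda>i. add_ball i s) \<longrightarrow> \<not> (\<omega> m = s \<and> \<omega> (Suc m) = t)"
    proof (subst AE_all_countable, intro allI, subst AE_all_countable, intro allI)
      fix s t :: state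
      show "AE \<omega> in ?M. t \<notin> range (\<lambda>i. add_ball i s) \<longrightarrow> \<not> (\<omega> m = s \<and> \<omega> (Suc m) = t)"
      proof (cases "t \<in> range (\<lambda>i. add_ball i s)")
        case False
        then have "pmf (step_pmf f s) t = 0" using set_pmf_step[of f s] by (auto simp: set_pmf_iff)
        then have "measure ?M {\<omega>. \<omega> m = s \<and> \<omega> (Suc m) = t} = 0"
          using bb_process_Markov_event[of m "\<lambda>\<omega>. \<omega> m = s" s f u t] by simp
        then have "{\<omega>. \<omega> m = s \<and> \<omega> (Suc m) = t} \<in> null_sets ?M"
          using measurable_history_event(2)[of m "\<lambda>\<omega>. \<omega> m = s" t f u]
          by (simp add: null_sets_def emeasure_eq_measure)
        from AE_not_in[OF this] show ?thesis by auto
      qed simp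
    qed
    then show "AE \<omega> in ?M. \<exists>i. \<omega> (Suc m) = add_ball i (\<omega> m)"
      by eventually_elim blast
  qed
  ultimately show ?thesis unfolding valid_def by eventually_elim blast
qed

section \<open>Pathwise facts about the losing bin\<close>

lemma all_bin: "(\<forall>i. P i) \<longleftrightarrow> P Bin1 \<and> P Bin2"
  by (metis bin.exhaust)

lemma balls_add_ball: "balls i (add_ball j s) = balls i s + (if i = j then 1 else 0)"
  by (cases i; cases j) auto

lemma add_ball_eq_iff [simp]: "add_ball i s = add_ball j s \<longleftrightarrow> i = j"
  by (cases i; cases j) auto

lemma other_other [simp]: "other (other i) = i"
  by (cases i) auto

lemma other_neq [simp]: "other i \<noteq> i" "i \<noteq> other i"
  by (cases i; simp)+

lemma neq_iff_other: "i \<noteq> j \<longleftrightarrow> i = other j"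
  by (cases i; cases j) auto

lemma valid_step: "valid u \<omega> \<Longrightarrow> \<exists>i. \<omega> (Suc m) = add_ball i (\<omega> m)"
  by (simp add: valid_def)

lemma valid_total: "valid u \<omega> \<Longrightarrow> balls i (\<omega> m) + balls (other i) (\<omega> m) = fst u + snd u + m"
proof (induction m)
  case 0
  then show ?case by (cases i) (auto simp: valid_def)
next
  case (Suc m)
  from valid_step[OF Suc.prems, of m] obtain j where "\<omega> (Suc m) = add_ball j (\<omega> m)" by blast
  with Suc show ?case by (auto simp: balls_add_ball neq_iff_other)
qed

lemma valid_total': "valid u \<omega> \<Longrightarrow> fst (\<omega> m) + snd (\<omega> m) = fst u + snd u + m"
  using valid_total[of u \<omega> Bin1 m] by simp

lemma valid_mono: "valid u \<omega> \<Longrightarrow> m \<le> n \<Longrightarrow> balls i (\<omega> m) \<le> balls i (\<omega> n)"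
proof (rule lift_Suc_mono_le[of "\<lambda>n. balls i (\<omega> n)"])
  fix m assume "valid u \<omega>"
  from valid_step[OF this, of m] show "balls i (\<omega> m) \<le> balls i (\<omega> (Suc m))"
    by (auto simp: balls_add_ball)
qed

text \<open>A stand-in for \<open>n < losing_number \<omega>\<close> that does not refer to the
  losing bin. Asking for a common time is no restriction on valid trajectories, where counts never
  decrease.\<close>

definition both :: "nat \<Rightarrow> (nat \<Rightarrow> state) \<Rightarrow> bool" where
  "both n \<omega> \<longleftrightarrow> (\<exists>m. \<forall>i. n < balls i (\<omega> m))"

text \<open>Some bin stays at most \<open>N\<close>, and its nondecreasing count is eventually equal
  to its maximum. From then on the other bin receives every ball, which gives \<open>THE\<close> and
  \<open>lim\<close> in the definitions their intended values.\<close>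

lemma valid_loser:
  assumes v: "valid u \<omega>" and nb: "\<not> both N \<omega>"
  obtains K where "\<And>m. K \<le> m \<Longrightarrow> balls (losing_bin \<omega>) (\<omega> m) = losing_number \<omega>"
proof -
  have "\<exists>i. \<forall>m. balls i (\<omega> m) \<le> N"
  proof (rule ccontr)
    assume "\<nexists>i. \<forall>m. balls i (\<omega> m) \<le> N"
    then have "\<forall>i. \<exists>m. N < balls i (\<omega> m)" by (auto simp: not_le)
    then obtain T where T: "\<And>i. N < balls i (\<omega> (T i))" by metis
    have "N < balls i (\<omega> (max (T Bin1) (T Bin2)))" for i
      using T[of i] valid_mono[OF v, of "T i" "max (T Bin1) (T Bin2)" i] by (cases i) auto
    with nb show False by (auto simp: both_def)
  qed
  then obtain i where i: "\<And>m. balls i (\<omega> m) \<le> N" by blast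
  define L where "L = Max (range (\<lambda>m. balls i (\<omega> m)))"
  have fin: "finite (range (\<lambda>m. balls i (\<omega> m)))" using i by (auto intro: finite_subset[of _ "{..N}"])
  have "L \<in> range (\<lambda>m. balls i (\<omega> m))" unfolding L_def by (rule Max_in[OF fin]) simp
  then obtain K where K: "balls i (\<omega> K) = L" by auto
  have KL: "balls i (\<omega> m) = L" if "K \<le> m" for m
  proof (rule antisym)
    show "balls i (\<omega> m) \<le> L" unfolding L_def by (rule Max_ge[OF fin]) simp
    show "L \<le> balls i (\<omega> m)" using valid_mono[OF v that, of i] K by simp
  qed
  have rec: "receives (other i) \<omega> m \<and> \<not> receives i \<omega> m" if "K \<le> m" for m
  proof -
    from valid_step[OF v, of m] obtain j where j: "\<omega> (Suc m) = add_ball j (\<omega> m)" by blast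
    have "balls i (\<omega> (Suc m)) = balls i (\<omega> m)" using KL[of m] KL[of "Suc m"] that by simp
    then have "j \<noteq> i" "\<not> receives i \<omega> m" unfolding receives_def j by (auto simp: balls_add_ball)
    then show ?thesis unfolding receives_def j by (auto simp: neq_iff_other)
  qed
  have "winning (other i) \<omega>" unfolding winning_def
    by (rule finite_subset[of _ "{..K}"]) (use rec in \<open>auto simp: not_le[symmetric] intro: ccontr\<close>)
  moreover have "\<not> winning i \<omega>"
  proof
    assume "winning i \<omega>"
    moreover have "{K..} \<subseteq> {m. \<not> receives i \<omega> m}" using rec by auto
    ultimately show False unfolding winning_def using infinite_Ici finite_subset by blast
  qed
  ultimately have "(THE i. winning i \<omega>) = other i"
    by (intro the_equality) (auto simp: neq_iff_other[symmetric])
  then have lb: "losing_bin \<omega> = i" by (simp add: losing_bin_def)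
  have "(\<lambda>m. balls i (\<omega> m)) \<longlonglongrightarrow> L"
    by (rule tendsto_eventually) (use KL in \<open>auto simp: eventually_sequentially\<close>)
  then have "losing_number \<omega> = L" by (simp add: losing_number_def lb limI)
  with lb KL show ?thesis by (intro that[of K]) simp
qed

lemma valid_losing_number_iff:
  assumes v: "valid u \<omega>" and nb: "\<not> both N \<omega>"
  shows "n < losing_number \<omega> \<longleftrightarrow> both n \<omega>"
proof -
  from valid_loser[OF v nb] obtain K
    where K: "\<And>m. K \<le> m \<Longrightarrow> balls (losing_bin \<omega>) (\<omega> m) = losing_number \<omega>" by blast
  show ?thesis
  proof
    assume n: "n < losing_number \<omega>"
    \<comment> \<open>Late enough for the loser to be final and for the other bin, which holds all
      remaining balls, to exceed \<open>n\<close>.\<close>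
    define m where "m = K + n + losing_number \<omega> + 1"
    have 1: "balls (losing_bin \<omega>) (\<omega> m) = losing_number \<omega>" by (rule K) (simp add: m_def)
    then have "n < balls (other (losing_bin \<omega>)) (\<omega> m)"
      using valid_total[OF v, of "losing_bin \<omega>" m] by (simp add: m_def)
    with 1 n have "n < balls i (\<omega> m)" for i
      by (cases "i = losing_bin \<omega>") (auto simp: neq_iff_other)
    then show "both n \<omega>" by (auto simp: both_def)
  next
    assume "both n \<omega>"
    then obtain m where "n < balls (losing_bin \<omega>) (\<omega> m)" by (auto simp: both_def)
    then show "n < losing_number \<omega>"
      using valid_mono[OF v, of m "max m K" "losing_bin \<omega>"] K[of "max m K"] by simp
  qed
qed

text \<open>Discrete intermediate values: the loser stops while the total grows, so its lead is lost
  eventually, and since one ball is added at a time the first loss of the lead is a tie.\<close>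

lemma valid_overtake:
  assumes v: "valid u \<omega>" and nb: "\<not> both N \<omega>"
    and ahead: "balls (other (losing_bin \<omega>)) (\<omega> m) < balls (losing_bin \<omega>) (\<omega> m)"
  obtains m' where "m < m'" "fst (\<omega> m') = snd (\<omega> m')"
proof -
  define i where "i = losing_bin \<omega>"
  from valid_loser[OF v nb] obtain K
    where K: "\<And>m. K \<le> m \<Longrightarrow> balls i (\<omega> m) = losing_number \<omega>" unfolding i_def by blast
  define P where "P k \<longleftrightarrow> m \<le> k \<and> balls i (\<omega> k) \<le> balls (other i) (\<omega> k)" for k
  have "P (m + K + 2 * losing_number \<omega>)"
    using valid_total[OF v, of i "m + K + 2 * losing_number \<omega>"] K[of "m + K + 2 * losing_number \<omega>"]
    by (simp add: P_def)
  then have P: "P (LEAST k. P k)" and least: "\<And>k. k < (LEAST k. P k) \<Longrightarrow> \<not> P k"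
    by (auto intro: LeastI dest: not_less_Least)
  have "(LEAST k. P k) \<noteq> m" using P ahead by (auto simp: P_def i_def)
  with P have "m < (LEAST k. P k)" by (auto simp: P_def)
  then obtain k where k: "(LEAST k. P k) = Suc k" "m \<le> k" by (metis less_imp_Suc_add le_add1)
  have "\<not> P k" using least[of k] k by simp
  with k have gt: "balls (other i) (\<omega> k) < balls i (\<omega> k)" by (simp add: P_def)
  from valid_step[OF v, of k] obtain j where j: "\<omega> (Suc k) = add_ball j (\<omega> k)" by blast
  have le: "balls i (\<omega> (Suc k)) \<le> balls (other i) (\<omega> (Suc k))" using P k by (simp add: P_def)
  have "balls i (\<omega> (Suc k)) = balls (other i) (\<omega> (Suc k))"
    using le gt unfolding j by (auto simp: balls_add_ball split: if_splits)
  then have "fst (\<omega> (Suc k)) = snd (\<omega> (Suc k))" by (cases i) auto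
  with k show ?thesis by (intro that[of "Suc k"]) auto
qed

section \<open>Visit probabilities\<close>

locale feedback_process = feedback +
  fixes x y :: nat
  assumes start_pos: "0 < x" "0 < y"
begin

abbreviation M where "M \<equiv> bb_process f (x, y)"

sublocale prob_space M
  by (rule prob_space_bb_process)

lemma sets_Collect: "Measurable.pred M P \<Longrightarrow> {\<omega>. P \<omega>} \<in> sets M"
  by (simp add: pred_def)

lemma AE_M: "AE \<omega> in M. valid (x, y) \<omega>"
  by (rule AE_valid)

lemma valid_ge: "valid (x, y) \<omega> \<Longrightarrow> x \<le> fst (\<omega> m)" "valid (x, y) \<omega> \<Longrightarrow> y \<le> snd (\<omega> m)"
  using valid_mono[of "(x, y)" \<omega> 0 m Bin1] valid_mono[of "(x, y)" \<omega> 0 m Bin2]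
  by (simp_all add: valid_def)

text \<open>The total determines the time, so \<open>(k, l)\<close> can only be visited at time
  \<open>k + l - (x + y)\<close>. The constraint \<open>S\<close> at time \<open>r\<close> is for
  trajectories that later make up a large imbalance.\<close>

definition visit_event :: "state set \<Rightarrow> nat \<Rightarrow> nat \<Rightarrow> nat \<Rightarrow> (nat \<Rightarrow> state) set" where
  "visit_event S r k l = {\<omega>. \<omega> r \<in> S \<and> \<omega> (k + l - (x + y)) = (k, l)}"

text \<open>
  For \<open>S = UNIV\<close> and \<open>r = 0\<close>: in the exponential embedding, this is the integral of the product of the densities of the times
  at which the two bins leave \<open>k\<close> and \<open>l\<close>, which explains why it converges.
\<close>

definition green :: "state set \<Rightarrow> nat \<Rightarrow> nat \<Rightarrow> nat \<Rightarrow> real" where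
  "green S r k l = prob (visit_event S r k l) * (f k * f l / (f k + f l))"

lemma visit_event_sets [measurable, simp]: "visit_event S r k l \<in> sets M"
  unfolding visit_event_def by (rule sets_Collect) measurable

lemma green_nonneg: "0 \<le> green S r k l"
  unfolding green_def by (intro mult_nonneg_nonneg divide_nonneg_nonneg add_nonneg_nonneg f_nonneg) simp

lemma green_le: "green S r k l \<le> green UNIV 0 k l"
proof -
  have "visit_event S r k l \<subseteq> visit_event UNIV 0 k l" by (auto simp: visit_event_def)
  then show ?thesis unfolding green_def
    by (intro mult_right_mono finite_measure_mono visit_event_sets divide_nonneg_nonneg
        mult_nonneg_nonneg add_nonneg_nonneg f_nonneg)
qed

lemma prob_visit_event:
  assumes "0 < k" "0 < l"
  shows "prob (visit_event S r k l) = green S r k l * (1 / f k + 1 / f l)"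
proof -
  have "1 / f k + 1 / f l = (f k + f l) / (f k * f l)" "f k + f l \<noteq> 0" "f k * f l \<noteq> 0"
    using f_pos[OF assms(1)] f_pos[OF assms(2)] by (simp_all add: add_divide_distrib)
  then show ?thesis by (simp add: green_def)
qed

lemma prob_visit_event_zero: "prob (visit_event S r 0 l) = 0" "prob (visit_event S r k 0) = 0"
proof -
  have *: "fst (\<omega> m) \<noteq> 0 \<and> snd (\<omega> m) \<noteq> 0" if "valid (x, y) \<omega>" for \<omega> m
    using valid_ge[OF that, of m] start_pos by auto
  have "AE \<omega> in M. \<omega> \<notin> visit_event S r 0 l"
    using AE_M
  proof eventually_elim
    case (elim \<omega>)
    show ?case using *[OF elim, of "0 + l - (x + y)"] by (auto simp: visit_event_def)
  qed
  then show "prob (visit_event S r 0 l) = 0" by (simp add: prob_eq_0)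
  have "AE \<omega> in M. \<omega> \<notin> visit_event S r k 0"
    using AE_M
  proof eventually_elim
    case (elim \<omega>)
    show ?case using *[OF elim, of "k + 0 - (x + y)"] by (auto simp: visit_event_def)
  qed
  then show "prob (visit_event S r k 0) = 0" by (simp add: prob_eq_0)
qed

text \<open>The factor in \<open>green\<close> is chosen so that the flow through an edge is
  \<open>green\<close> over the feedback of the bin that does not receive the ball. The bound on
  \<open>r\<close> makes the visit event part of the history at departure.\<close>

lemma prob_step1:
  assumes "0 < l" "r \<le> k + l - (x + y)"
  shows "prob {\<omega>. \<omega> \<in> visit_event S r k l \<and> \<omega> (Suc (k + l - (x + y))) = (Suc k, l)}
         = green S r k l / f l"
proof (cases "k = 0")
  case True
  have "prob {\<omega>. \<omega> \<in> visit_event S r k l \<and> \<omega> (Suc (k + l - (x + y))) = (Suc k, l)} \<le> prob (visit_event S r k l)"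
    by (intro finite_measure_mono) auto
  then show ?thesis using True prob_visit_event_zero by (simp add: green_def measure_le_0_iff)
next
  case False
  then have pos: "0 < f k" "0 < f l" using assms f_pos by auto
  have "prob {\<omega>. \<omega> \<in> visit_event S r k l \<and> \<omega> (Suc (k + l - (x + y))) = (Suc k, l)}
      = prob {\<omega>. \<omega> \<in> visit_event S r k l} * pmf (step_pmf f (k, l)) (Suc k, l)"
    by (rule bb_process_Markov_event) (use assms in \<open>auto simp: visit_event_def\<close>)
  also have "pmf (step_pmf f (k, l)) (Suc k, l) = f k / (f k + f l)"
    using pmf_step_pmf[of f "(k, l)" Bin1] pos by simp
  finally show ?thesis using pos by (simp add: green_def)
qed

lemma prob_step2:
  assumes "0 < k" "r \<le> k + l - (x + y)"
  shows "prob {\<omega>. \<omega> \<in> visit_event S r k l \<and> \<omega> (Suc (k + l - (x + y))) = (k, Suc l)}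
         = green S r k l / f k"
proof (cases "l = 0")
  case True
  have "prob {\<omega>. \<omega> \<in> visit_event S r k l \<and> \<omega> (Suc (k + l - (x + y))) = (k, Suc l)} \<le> prob (visit_event S r k l)"
    by (intro finite_measure_mono) auto
  then show ?thesis using True prob_visit_event_zero by (simp add: green_def measure_le_0_iff)
next
  case False
  then have pos: "0 < f k" "0 < f l" using assms f_pos by auto
  have "prob {\<omega>. \<omega> \<in> visit_event S r k l \<and> \<omega> (Suc (k + l - (x + y))) = (k, Suc l)}
      = prob {\<omega>. \<omega> \<in> visit_event S r k l} * pmf (step_pmf f (k, l)) (k, Suc l)"
    by (rule bb_process_Markov_event) (use assms in \<open>auto simp: visit_event_def\<close>)
  also have "pmf (step_pmf f (k, l)) (k, Suc l) = f l / (f k + f l)"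
    using pmf_step_pmf[of f "(k, l)" Bin2] pos by simp
  finally show ?thesis using pos by (simp add: green_def)
qed

lemma step_event_sets:
  "{\<omega>. \<omega> \<in> visit_event S r k l \<and> \<omega> m = s} \<in> sets M"
  by (rule sets_Collect) measurable

text \<open>Forward equation: almost surely \<open>(Suc k, Suc l)\<close> is entered from exactly
  one of its two predecessors, and the edge flows add up. Above level \<open>x + y + r\<close> the
  constraint at time \<open>r\<close> is already decided at the predecessor.\<close>

lemma harmonic_green: "harmonic (x + y + r) (green S r)"
proof -
  have "(f (Suc k) + f (Suc l)) * green S r (Suc k) (Suc l) =
      f (Suc k) * green S r k (Suc l) + f (Suc l) * green S r (Suc k) l"
    if N: "x + y + r < Suc k + Suc l" for k l
  proof -
    define m where "m = Suc (k + l) - (x + y)"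
    have m: "Suc k + Suc l - (x + y) = Suc m" "k + Suc l - (x + y) = m" "Suc k + l - (x + y) = m" "r \<le> m"
      using N by (auto simp: m_def)
    define A where "A = {\<omega>. \<omega> \<in> visit_event S r k (Suc l) \<and> \<omega> (Suc m) = (Suc k, Suc l)}"
    define B where "B = {\<omega>. \<omega> \<in> visit_event S r (Suc k) l \<and> \<omega> (Suc m) = (Suc k, Suc l)}"
    have eqs: "visit_event S r (Suc k) (Suc l) = {\<omega>. \<omega> r \<in> S \<and> \<omega> (Suc m) = (Suc k, Suc l)}"
      "A = {\<omega>. (\<omega> r \<in> S \<and> \<omega> m = (k, Suc l)) \<and> \<omega> (Suc m) = (Suc k, Suc l)}"
      "B = {\<omega>. (\<omega> r \<in> S \<and> \<omega> m = (Suc k, l)) \<and> \<omega> (Suc m) = (Suc k, Suc l)}"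
      unfolding A_def B_def visit_event_def m by blast+
    have sets: "A \<in> sets M" "B \<in> sets M" unfolding A_def B_def by (rule step_event_sets)+
    have "prob (visit_event S r (Suc k) (Suc l)) = prob (A \<union> B)"
    proof (rule finite_measure_eq_AE)
      show "AE \<omega> in M. \<omega> \<in> visit_event S r (Suc k) (Suc l) \<longleftrightarrow> \<omega> \<in> A \<union> B"
        using AE_M
      proof eventually_elim
        case (elim \<omega>)
        from valid_step[OF elim, of m] obtain i where i: "\<omega> (Suc m) = add_ball i (\<omega> m)" by blast
        show ?case
          unfolding eqs i by (cases i; cases "\<omega> m") (auto simp: i)
      qed
    qed (use sets in auto)
    also have "\<dots> = prob A + prob B"
      by (rule finite_measure_Union[OF sets]) (auto simp: eqs)
    also have "prob A = green S r k (Suc l) / f (Suc l)"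
      using prob_step1[of "Suc l" r k S] m by (simp add: A_def)
    also have "prob B = green S r (Suc k) l / f (Suc k)"
      using prob_step2[of "Suc k" r l S] m by (simp add: B_def)
    finally show ?thesis using f_pos[of "Suc k"] f_pos[of "Suc l"]
      by (simp add: green_def[of S r "Suc k" "Suc l"] field_simps)
  qed
  then show ?thesis unfolding harmonic_def by (simp add: green_def f_0)
qed

lemma green_limit:
  obtains \<gamma> C where "0 < \<gamma>" "0 \<le> C"
    "\<And>k l. x + y \<le> k + l \<Longrightarrow> \<bar>green UNIV 0 k l - \<gamma>\<bar> \<le> C * (tail (Suc k) + tail (Suc l))"
proof -
  have harm: "harmonic (x + y) (green UNIV 0)" using harmonic_green[of 0 UNIV] by simp
  obtain \<gamma> C where C: "0 \<le> C"
    and *: "\<And>k l. x + y \<le> k + l \<Longrightarrow> \<bar>green UNIV 0 k l - \<gamma>\<bar> \<le> C * (tail (Suc k) + tail (Suc l))"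
    by (rule harmonic_tendsto[OF harm]) (rule that)
  have "(\<lambda>m. green UNIV 0 m m - \<gamma>) \<longlonglongrightarrow> 0"
  proof (rule tendsto_0_le[where K = 1])
    have "(\<lambda>m. C * (tail (Suc m) + tail (Suc m))) \<longlonglongrightarrow> C * (0 + 0)"
      by (intro tendsto_intros LIMSEQ_Suc tail_tendsto_0)
    then show "(\<lambda>m. C * (tail (Suc m) + tail (Suc m))) \<longlonglongrightarrow> 0" by simp
    show "\<forall>\<^sub>F m in sequentially. norm (green UNIV 0 m m - \<gamma>) \<le> norm (C * (tail (Suc m) + tail (Suc m))) * 1"
      unfolding eventually_sequentially
    proof (intro exI allI impI)
      fix m assume "x + y \<le> m"
      then show "norm (green UNIV 0 m m - \<gamma>) \<le> norm (C * (tail (Suc m) + tail (Suc m))) * 1"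
        using *[of m m] by simp
    qed
  qed
  then have lim: "(\<lambda>m. green UNIV 0 m m) \<longlonglongrightarrow> \<gamma>" by (simp add: LIM_zero_iff)
  have "prob (visit_event UNIV 0 x y) = 1"
    using bb_process_initial[of f "(x, y)"] by (simp add: visit_event_def)
  then have "0 < green UNIV 0 x y" using f_pos[OF start_pos(1)] f_pos[OF start_pos(2)]
    by (simp add: green_def)
  from harmonic_limit_pos[OF harm green_nonneg this start_pos lim] C * show ?thesis
    by (rule that)
qed

text \<open>The event is split by the step that first brings both bins above \<open>n\<close>: it
  leads from \<open>(n, l)\<close> to \<open>(Suc n, l)\<close>, or is the mirror image, with
  \<open>l = Suc n + j\<close>. The bounds on \<open>n\<close> put the start outside the target
  region.\<close>

lemma prob_both:
  assumes n: "x \<le> n" "y \<le> n"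
  shows "(\<lambda>j. (green UNIV 0 n (Suc n + j) + green UNIV 0 (Suc n + j) n) / f (Suc n + j))
           sums prob {\<omega>. both n \<omega>}"
proof -
  define t where "t j = n + (Suc n + j) - (x + y)" for j
  have t': "n + (Suc n + j) - (x + y) = t j" "Suc n + j + n - (x + y) = t j" for j
    by (simp_all add: t_def add.commute)
  define A where "A j = {\<omega>. \<omega> \<in> visit_event UNIV 0 n (Suc n + j) \<and> \<omega> (Suc (t j)) = (Suc n, Suc n + j)}" for j
  define B where "B j = {\<omega>. \<omega> \<in> visit_event UNIV 0 (Suc n + j) n \<and> \<omega> (Suc (t j)) = (Suc n + j, Suc n)}" for j
  define V where "V = {\<omega>. valid (x, y) \<omega>}"
  define E where "E j = (A j \<union> B j) \<inter> V" for j
  have A_eq: "A j = {\<omega>. \<omega> (t j) = (n, Suc n + j) \<and> \<omega> (Suc (t j)) = (Suc n, Suc n + j)}" for j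
    unfolding A_def visit_event_def t' by blast
  have B_eq: "B j = {\<omega>. \<omega> (t j) = (Suc n + j, n) \<and> \<omega> (Suc (t j)) = (Suc n + j, Suc n)}" for j
    unfolding B_def visit_event_def t' by blast
  have AB [measurable]: "A j \<in> sets M" "B j \<in> sets M" for j unfolding A_def B_def by (rule step_event_sets)+
  have V[measurable]: "V \<in> sets M" unfolding V_def valid_def by (rule sets_Collect) measurable
  define Q where "Q s \<longleftrightarrow> n < fst s \<and> n < snd s" for s :: state
  have both: "both n \<omega> \<longleftrightarrow> (\<exists>m. Q (\<omega> m))" for \<omega>
    by (simp add: both_def Q_def all_bin)
  have Qmono: "Q (\<omega> m')" if "Q (\<omega> m)" "m \<le> m'" "\<omega> \<in> V" for \<omega> m m'
    using that valid_mono[of "(x, y)" \<omega> m m' Bin1] valid_mono[of "(x, y)" \<omega> m m' Bin2]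
    by (auto simp: Q_def V_def)
  have E_entry: "\<not> Q (\<omega> (t j)) \<and> Q (\<omega> (Suc (t j)))" if "\<omega> \<in> E j" for \<omega> j
    using that by (auto simp: E_def A_eq B_eq Q_def)
  \<comment> \<open>On valid trajectories the region is never left again, so it is entered at one
    time only, and that time determines \<open>j\<close>.\<close>
  have "disjoint_family E"
    unfolding disjoint_family_on_def
  proof (intro ballI impI, rule ccontr)
    fix i j assume "i \<noteq> j" "E i \<inter> E j \<noteq> {}"
    then obtain \<omega> where w: "\<omega> \<in> E i" "\<omega> \<in> E j" by blast
    then have V: "\<omega> \<in> V" by (simp add: E_def)
    have "\<not> t i < t j" "\<not> t j < t i"
      using E_entry[OF w(1)] E_entry[OF w(2)]
        Qmono[of \<omega> "Suc (t i)" "t j", OF _ _ V] Qmono[of \<omega> "Suc (t j)" "t i", OF _ _ V]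
      by (auto simp: Suc_le_eq)
    then have "t i = t j" by simp
    with \<open>i \<noteq> j\<close> n show False unfolding t_def by arith
  qed
  moreover have Es: "range E \<subseteq> sets M" by (auto simp: E_def)
  ultimately have "(\<lambda>j. prob (E j)) sums prob (\<Union>j. E j)"
    by (intro finite_measure_UNION)
  moreover have "prob (\<Union>j. E j) = prob {\<omega>. both n \<omega>}"
  proof (rule finite_measure_eq_AE)
    show "{\<omega>. both n \<omega>} \<in> sets M" unfolding both by (rule sets_Collect) measurable
    show "AE \<omega> in M. \<omega> \<in> (\<Union>j. E j) \<longleftrightarrow> \<omega> \<in> {\<omega>. both n \<omega>}"
      using AE_M
    proof eventually_elim
      case (elim \<omega>)
      have V: "\<omega> \<in> V" using elim by (simp add: V_def)
      show ?case
      proof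
        assume "\<omega> \<in> (\<Union>j. E j)"
        then show "\<omega> \<in> {\<omega>. both n \<omega>}" using E_entry both by blast
      next
        assume "\<omega> \<in> {\<omega>. both n \<omega>}"
        then have ex: "\<exists>m. Q (\<omega> m)" by (simp add: both)
        have "\<not> Q (\<omega> 0)" using elim n by (simp add: valid_def Q_def)
        have "\<exists>m. \<not> Q (\<omega> m) \<and> Q (\<omega> (Suc m))"
        proof (rule ccontr)
          assume step: "\<nexists>m. \<not> Q (\<omega> m) \<and> Q (\<omega> (Suc m))"
          have "\<not> Q (\<omega> m)" for m
            by (induction m) (use \<open>\<not> Q (\<omega> 0)\<close> step in auto)
          with ex show False by blast
        qed
        then obtain m where m: "\<not> Q (\<omega> m)" "Q (\<omega> (Suc m))" by blast
        obtain k l where kl: "\<omega> m = (k, l)" by (cases "\<omega> m")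
        have tot: "k + l = x + y + m" using valid_total'[OF elim, of m] kl by simp
        from valid_step[OF elim, of m] obtain i where i: "\<omega> (Suc m) = add_ball i (\<omega> m)" by blast
        show "\<omega> \<in> (\<Union>j. E j)"
        proof (cases i)
          case Bin1
          then have "k = n" "n < l" using m kl i by (auto simp: Q_def)
          then obtain j where l: "l = Suc n + j" by (metis add_Suc less_imp_Suc_add)
          have "t j = m" using tot l \<open>k = n\<close> by (simp add: t_def)
          then have "\<omega> \<in> A j" using kl i Bin1 l \<open>k = n\<close>
            by (auto simp: A_eq)
          then show ?thesis using V by (auto simp: E_def)
        next
          case Bin2
          then have "l = n" "n < k" using m kl i by (auto simp: Q_def)
          then obtain j where k: "k = Suc n + j" by (metis add_Suc less_imp_Suc_add)
          have "t j = m" using tot k \<open>l = n\<close> by (simp add: t_def)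
          then have "\<omega> \<in> B j" using kl i Bin2 k \<open>l = n\<close>
            by (auto simp: B_eq)
          then show ?thesis using V by (auto simp: E_def)
        qed
      qed
    qed
  qed (use Es in auto)
  moreover have "prob (E j) = (green UNIV 0 n (Suc n + j) + green UNIV 0 (Suc n + j) n) / f (Suc n + j)" for j
  proof -
    have "prob (E j) = prob (A j \<union> B j)"
    proof (rule finite_measure_eq_AE)
      show "AE \<omega> in M. \<omega> \<in> E j \<longleftrightarrow> \<omega> \<in> A j \<union> B j"
        using AE_M by eventually_elim (auto simp: E_def V_def)
    qed (auto simp: E_def)
    also have "\<dots> = prob (A j) + prob (B j)"
      by (rule finite_measure_Union[OF AB]) (auto simp: A_eq B_eq)
    also have "prob (A j) = green UNIV 0 n (Suc n + j) / f (Suc n + j)"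
      unfolding A_def t_def by (rule prob_step1) auto
    also have "prob (B j) = green UNIV 0 (Suc n + j) n / f (Suc n + j)"
      unfolding B_def t'(2)[symmetric] by (rule prob_step2) auto
    finally show ?thesis by (simp add: add_divide_distrib)
  qed
  ultimately show ?thesis by simp
qed

text \<open>At both sites of each summand \<open>green\<close> is within a multiple of
  \<open>tail (Suc n)\<close> of \<open>\<gamma>\<close>. Summed against \<open>1 / f\<close>, the
  error is quadratic in the tail and thus of lower order.\<close>

lemma prob_both_bound:
  assumes C: "0 \<le> C"
    and lim: "\<And>k l. x + y \<le> k + l \<Longrightarrow> \<bar>green UNIV 0 k l - \<gamma>\<bar> \<le> C * (tail (Suc k) + tail (Suc l))"
    and n: "x \<le> n" "y \<le> n"
  shows "\<bar>prob {\<omega>. both n \<omega>} - 2 * \<gamma> * tail (Suc n)\<bar> \<le> 4 * C * tail (Suc n) * tail (Suc n)"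
proof -
  let ?g = "\<lambda>j. (green UNIV 0 n (Suc n + j) + green UNIV 0 (Suc n + j) n) / f (Suc n + j)"
  have tail_sums: "(\<lambda>j. c * (1 / f (Suc n + j))) sums (c * tail (Suc n))" for c
    unfolding tail_def by (intro sums_mult summable_sums summable_shift)
  have diff: "(\<lambda>j. ?g j - 2 * \<gamma> * (1 / f (Suc n + j))) sums (prob {\<omega>. both n \<omega>} - 2 * \<gamma> * tail (Suc n))"
    by (intro sums_diff prob_both[OF n] tail_sums)
  have le: "\<bar>?g j - 2 * \<gamma> * (1 / f (Suc n + j))\<bar> \<le> 4 * C * tail (Suc n) * (1 / f (Suc n + j))" for j
  proof -
    have "\<bar>green UNIV 0 n (Suc n + j) - \<gamma>\<bar> \<le> C * (tail (Suc n) + tail (Suc (Suc n + j)))"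
      "\<bar>green UNIV 0 (Suc n + j) n - \<gamma>\<bar> \<le> C * (tail (Suc (Suc n + j)) + tail (Suc n))"
      using n by (intro lim; simp)+
    moreover have "C * tail (Suc (Suc n + j)) \<le> C * tail (Suc n)"
      by (intro mult_left_mono tail_antimono C) simp
    ultimately have "\<bar>(green UNIV 0 n (Suc n + j) + green UNIV 0 (Suc n + j) n) - 2 * \<gamma>\<bar> \<le> 4 * C * tail (Suc n)"
      by (simp add: distrib_left)
    then have "\<bar>(green UNIV 0 n (Suc n + j) + green UNIV 0 (Suc n + j) n) - 2 * \<gamma>\<bar> * (1 / f (Suc n + j))
        \<le> 4 * C * tail (Suc n) * (1 / f (Suc n + j))"
      using f_nonneg by (intro mult_right_mono) auto
    moreover have "?g j - 2 * \<gamma> * (1 / f (Suc n + j)) =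
        ((green UNIV 0 n (Suc n + j) + green UNIV 0 (Suc n + j) n) - 2 * \<gamma>) * (1 / f (Suc n + j))"
      by (simp add: diff_divide_distrib)
    ultimately show ?thesis using f_nonneg[of "Suc n + j"] by (simp only: abs_mult) simp
  qed
  have "norm (suminf (\<lambda>j. ?g j - 2 * \<gamma> * (1 / f (Suc n + j)))) \<le> (\<Sum>j. 4 * C * tail (Suc n) * (1 / f (Suc n + j)))"
    by (rule norm_suminf_le) (use le tail_sums in \<open>auto simp: sums_iff simp del: mult_1_right times_divide_eq_right\<close>)
  then show ?thesis
    using sums_unique[OF diff] sums_unique[OF tail_sums[of "4 * C * tail (Suc n)"]] by simp
qed

section \<open>Almost sure finiteness and the law of the losing number\<close>

lemma sets_both: "{\<omega>. both n \<omega>} \<in> sets M"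
proof -
  have "{\<omega>. both n \<omega>} = {\<omega>. \<exists>m. n < fst (\<omega> m) \<and> n < snd (\<omega> m)}"
    by (simp add: both_def all_bin)
  then show ?thesis by (simp only:) (rule sets_Collect, measurable)
qed

text \<open>The same estimate shows that almost surely one bin stays bounded: the intersection of
  all \<open>both N\<close> lies in each of them, and their probabilities tend to zero.\<close>

lemma AE_not_both: "AE \<omega> in M. \<exists>N. \<not> both N \<omega>"
proof -
  obtain \<gamma> C where \<gamma>: "0 < \<gamma>" and C: "0 \<le> C"
    and lim: "\<And>k l. x + y \<le> k + l \<Longrightarrow> \<bar>green UNIV 0 k l - \<gamma>\<bar> \<le> C * (tail (Suc k) + tail (Suc l))"
    by (rule green_limit) (rule that)
  have sets: "{\<omega>. \<forall>N. both N \<omega>} \<in> sets M"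
  proof -
    have "{\<omega>. \<forall>N. both N \<omega>} = (\<Inter>N. {\<omega>. both N \<omega>})" by auto
    then show ?thesis using sets_both by auto
  qed
  have "prob {\<omega>. \<forall>N. both N \<omega>} \<le> 0"
  proof (rule LIMSEQ_le_const)
    have "(\<lambda>n. 2 * \<gamma> * tail (Suc n) + 4 * C * tail (Suc n) * tail (Suc n)) \<longlonglongrightarrow> 2 * \<gamma> * 0 + 4 * C * 0 * 0"
      by (intro tendsto_intros LIMSEQ_Suc tail_tendsto_0)
    then show "(\<lambda>n. 2 * \<gamma> * tail (Suc n) + 4 * C * tail (Suc n) * tail (Suc n)) \<longlonglongrightarrow> 0" by simp
    have "prob {\<omega>. \<forall>N. both N \<omega>} \<le> 2 * \<gamma> * tail (Suc n) + 4 * C * tail (Suc n) * tail (Suc n)"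
      if "max x y \<le> n" for n
    proof -
      have "prob {\<omega>. \<forall>N. both N \<omega>} \<le> prob {\<omega>. both n \<omega>}"
        by (intro finite_measure_mono sets_both) auto
      then show ?thesis using prob_both_bound[OF C lim, of n] that by simp
    qed
    then show "\<exists>N. \<forall>n\<ge>N. prob {\<omega>. \<forall>N. both N \<omega>} \<le> 2 * \<gamma> * tail (Suc n) + 4 * C * tail (Suc n) * tail (Suc n)"
      by blast
  qed
  then have "prob {\<omega>. \<forall>N. both N \<omega>} = 0" by (simp add: measure_le_0_iff)
  then have "AE \<omega> in M. \<omega> \<notin> {\<omega>. \<forall>N. both N \<omega>}" using sets by (subst (asm) prob_eq_0) auto
  then show ?thesis by simp
qed

lemma prob_losing_number: "prob {\<omega>. n < losing_number \<omega>} = prob {\<omega>. both n \<omega>}"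
proof (rule finite_measure_eq_AE)
  show "AE \<omega> in M. \<omega> \<in> {\<omega>. n < losing_number \<omega>} \<longleftrightarrow> \<omega> \<in> {\<omega>. both n \<omega>}"
    using AE_M AE_not_both
  proof eventually_elim
    case (elim \<omega>)
    then show ?case using valid_losing_number_iff[OF elim(1)] by blast
  qed
  show "{\<omega>. n < losing_number \<omega>} \<in> sets M" by (rule sets_Collect) measurable
qed (rule sets_both)

section \<open>Splitting the event that the loser has at least its share\<close>

definition balanced :: "real \<Rightarrow> nat \<Rightarrow> (nat \<Rightarrow> state) set" where
  "balanced \<alpha> n = {\<omega>. \<forall>i. \<alpha> * real n \<le> real (balls i (\<omega> (n - (x + y))))}"

text \<open>The threshold fits states with \<open>n\<close> balls in which one bin holds fewer than
  \<open>\<alpha> * n\<close>: the other then leads by more than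
  \<open>(1 - 2 * \<alpha>) * n\<close>.\<close>

definition unbalanced_states :: "real \<Rightarrow> nat \<Rightarrow> state set" where
  "unbalanced_states \<alpha> n = {s. (1 - 2 * \<alpha>) * real n \<le> \<bar>real (fst s) - real (snd s)\<bar>}"

text \<open>\<open>n - n div 2\<close> is half of \<open>n\<close> rounded up, so the union runs
  over all diagonal sites on or above level \<open>n\<close>.\<close>

definition overtaking :: "real \<Rightarrow> nat \<Rightarrow> (nat \<Rightarrow> state) set" where
  "overtaking \<alpha> n = (\<Union>i. visit_event (unbalanced_states \<alpha> n) (n - (x + y)) (n - n div 2 + i) (n - n div 2 + i))"

lemma balanced_eq: "balanced \<alpha> n =
    {\<omega>. \<alpha> * real n \<le> real (fst (\<omega> (n - (x + y)))) \<and> \<alpha> * real n \<le> real (snd (\<omega> (n - (x + y))))}"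
  by (simp add: balanced_def all_bin)

lemma sets_balanced [simp]: "balanced \<alpha> n \<in> sets M"
  unfolding balanced_eq by (rule sets_Collect) measurable

lemma sets_overtaking [simp]: "overtaking \<alpha> n \<in> sets M"
  unfolding overtaking_def by auto

text \<open>A balanced state serves whichever bin loses. If the loser has its share but the other
  bin does not, the loser is far ahead, and by \<open>valid_overtake\<close> the trajectory later
  meets the diagonal.\<close>

lemma loser_has_more_than_bounds:
  assumes v: "valid (x, y) \<omega>" and nb: "\<not> both N \<omega>" and \<alpha>: "\<alpha> < 1 / 2" and n: "x + y \<le> n"
  shows "\<omega> \<in> balanced \<alpha> n \<Longrightarrow> loser_has_more_than \<alpha> n \<omega>"
    and "loser_has_more_than \<alpha> n \<omega> \<Longrightarrow> \<omega> \<in> balanced \<alpha> n \<union> overtaking \<alpha> n"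
proof -
  define m where "m = n - (x + y)"
  define i where "i = losing_bin \<omega>"
  have tot: "balls j (\<omega> k) + balls (other j) (\<omega> k) = x + y + k" for j k
    using valid_total[OF v, of j k] by simp
  have "balls Bin1 (\<omega> k) + balls Bin2 (\<omega> k) = n \<longleftrightarrow> k = m" for k
    using tot[of Bin1 k] n unfolding m_def other.simps by arith
  then have iff: "loser_has_more_than \<alpha> n \<omega> \<longleftrightarrow> \<alpha> * real n \<le> real (balls i (\<omega> m))"
    unfolding loser_has_more_than_def i_def by auto
  show "\<omega> \<in> balanced \<alpha> n \<Longrightarrow> loser_has_more_than \<alpha> n \<omega>"
    unfolding iff balanced_def m_def by simp
  assume "loser_has_more_than \<alpha> n \<omega>"
  with iff have ge: "\<alpha> * real n \<le> real (balls i (\<omega> m))" by simp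
  show "\<omega> \<in> balanced \<alpha> n \<union> overtaking \<alpha> n"
  proof (cases "\<alpha> * real n \<le> real (balls (other i) (\<omega> m))")
    case True
    with ge have "\<alpha> * real n \<le> real (balls j (\<omega> m))" for j
      by (cases "j = i") (auto simp: neq_iff_other)
    then show ?thesis unfolding balanced_def m_def by simp
  next
    case False
    have sum_n: "real (balls i (\<omega> m)) + real (balls (other i) (\<omega> m)) = real n"
      using tot[of i m] n unfolding m_def by linarith
    have "0 < n" using n start_pos by simp
    then have "2 * (\<alpha> * real n) < real n" using \<alpha> by simp
    then have "balls (other i) (\<omega> m) < balls i (\<omega> m)" using False sum_n by linarith
    from valid_overtake[OF v nb, of m] this obtain m'
      where m': "m < m'" "fst (\<omega> m') = snd (\<omega> m')" unfolding i_def by blast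
    define j where "j = fst (\<omega> m')"
    have j: "\<omega> m' = (j, j)" using m' by (simp add: j_def prod_eq_iff)
    have tj: "j + j = x + y + m'" using valid_total'[OF v, of m'] j by simp
    have hj: "n - n div 2 \<le> j" using tj m'(1) n unfolding m_def by linarith
    have "real (balls i (\<omega> m)) - real (balls (other i) (\<omega> m)) = \<bar>real (fst (\<omega> m)) - real (snd (\<omega> m))\<bar>"
      using \<open>balls (other i) (\<omega> m) < balls i (\<omega> m)\<close> by (cases i) auto
    then have "\<omega> m \<in> unbalanced_states \<alpha> n"
      using False sum_n unfolding unbalanced_states_def by (simp add: algebra_simps)
    moreover have "j + j - (x + y) = m'" using tj by simp
    ultimately have "\<omega> \<in> visit_event (unbalanced_states \<alpha> n) (n - (x + y)) j j"
      unfolding visit_event_def using j m_def by simp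
    moreover obtain d where "j = n - n div 2 + d" using hj le_Suc_ex by blast
    ultimately show ?thesis unfolding overtaking_def by blast
  qed
qed

lemma prob_loser_has_more_than_bounds:
  assumes \<alpha>: "\<alpha> < 1 / 2" and n: "x + y \<le> n"
  shows "prob (balanced \<alpha> n) \<le> prob {\<omega>. loser_has_more_than \<alpha> n \<omega>}"
    and "prob {\<omega>. loser_has_more_than \<alpha> n \<omega>} \<le> prob (balanced \<alpha> n) + prob (overtaking \<alpha> n)"
proof -
  have s: "{\<omega>. loser_has_more_than \<alpha> n \<omega>} \<in> sets M"
    by (rule sets_Collect) (rule measurable_loser_has_more_than)
  have ae: "AE \<omega> in M. (\<omega> \<in> balanced \<alpha> n \<longrightarrow> loser_has_more_than \<alpha> n \<omega>) \<and>
     (loser_has_more_than \<alpha> n \<omega> \<longrightarrow> \<omega> \<in> balanced \<alpha> n \<union> overtaking \<alpha> n)"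
    using AE_M AE_not_both
  proof eventually_elim
    case (elim \<omega>)
    then obtain N where "\<not> both N \<omega>" by blast
    from loser_has_more_than_bounds[OF elim(1) this \<alpha> n] show ?case by blast
  qed
  show "prob (balanced \<alpha> n) \<le> prob {\<omega>. loser_has_more_than \<alpha> n \<omega>}"
    by (intro finite_measure_mono_AE s) (use ae in auto)
  have "prob {\<omega>. loser_has_more_than \<alpha> n \<omega>} \<le> prob (balanced \<alpha> n \<union> overtaking \<alpha> n)"
    by (intro finite_measure_mono_AE) (use ae in auto)
  also have "\<dots> \<le> prob (balanced \<alpha> n) + prob (overtaking \<alpha> n)"
    by (intro measure_Un_le) auto
  finally show "prob {\<omega>. loser_has_more_than \<alpha> n \<omega>} \<le> prob (balanced \<alpha> n) + prob (overtaking \<alpha> n)" .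
qed

text \<open>Restricted to unbalanced states at level \<open>n\<close>, \<open>green\<close> is
  harmonic above that level, at most \<open>B\<close> on it and zero near the diagonal, so
  \<open>harmonic_unbalanced_le\<close> gains a factor \<open>1 / n\<close> at each diagonal site. A
  union bound over these sites produces the tail.\<close>

lemma prob_overtaking:
  obtains B where "0 \<le> B"
    "\<And>\<alpha> n. \<alpha> < 1 / 2 \<Longrightarrow> x + y \<le> n \<Longrightarrow>
       prob (overtaking \<alpha> n) \<le> 2 * B / ((1 - 2 * \<alpha>)\<^sup>2 * real n) * tail (n - n div 2)"
proof -
  have "harmonic (x + y) (green UNIV 0)" using harmonic_green[of 0 UNIV] by simp
  then obtain B where B: "0 \<le> B" "\<And>k l. x + y \<le> k + l \<Longrightarrow> \<bar>green UNIV 0 k l\<bar> \<le> B"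
    by (rule harmonic_bounded) (rule that)
  have "prob (overtaking \<alpha> n) \<le> 2 * B / ((1 - 2 * \<alpha>)\<^sup>2 * real n) * tail (n - n div 2)"
    if \<alpha>: "\<alpha> < 1 / 2" and n: "x + y \<le> n" for \<alpha> n
  proof -
    define r where "r = n - (x + y)"
    define S where "S = unbalanced_states \<alpha> n"
    define h where "h = n - n div 2"
    define K where "K = B / ((1 - 2 * \<alpha>)\<^sup>2 * real n)"
    have xyr: "x + y + r = n" using n by (simp add: r_def)
    have h: "n \<le> 2 * (h + i)" for i unfolding h_def by presburger
    have h0: "0 < h + i" for i using n start_pos h[of i] by (cases "h + i") auto
    have K: "green S r (h + i) (h + i) \<le> K" for i
      unfolding K_def
    proof (rule harmonic_unbalanced_le[where G = "green S r"])
      show "harmonic n (green S r)" using harmonic_green[of r S] xyr by simp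
      show "2 \<le> n" using n start_pos by linarith
      show "green S r k l \<le> B" if "k + l = n" for k l
        using green_le[of S r k l] B(2)[of k l] that n by linarith
      show "green S r k l \<le> 0" if "k + l = n" "\<bar>real k - real l\<bar> < (1 - 2 * \<alpha>) * real n" for k l
      proof -
        have "visit_event S r k l = {}"
          using that unfolding visit_event_def S_def unbalanced_states_def by (auto simp: r_def)
        then show ?thesis by (simp add: green_def)
      qed
      show "n \<le> 2 * (h + i)" by (rule h)
    qed (use \<alpha> B in auto)
    have le: "prob (visit_event S r (h + i) (h + i)) \<le> 2 * K * (1 / f (h + i))" for i
    proof -
      have "prob (visit_event S r (h + i) (h + i)) = green S r (h + i) (h + i) * (2 * (1 / f (h + i)))"
        using prob_visit_event[OF h0[of i] h0[of i], of S r] by simp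
      also have "\<dots> \<le> K * (2 * (1 / f (h + i)))"
        using f_nonneg by (intro mult_right_mono K) auto
      finally show ?thesis by (simp add: mult.commute)
    qed
    have sm: "summable (\<lambda>i. 2 * K * (1 / f (h + i)))" by (intro summable_mult summable_shift)
    have sm': "summable (\<lambda>i. prob (visit_event S r (h + i) (h + i)))"
      by (rule summable_comparison_test'[OF sm, of 0]) (use le in simp)
    have "prob (overtaking \<alpha> n) \<le> (\<Sum>i. prob (visit_event S r (h + i) (h + i)))"
      unfolding overtaking_def S_def[symmetric] r_def[symmetric] h_def[symmetric]
      by (rule finite_measure_subadditive_countably[OF _ sm']) auto
    also have "\<dots> \<le> (\<Sum>i. 2 * K * (1 / f (h + i)))" by (rule suminf_le[OF le sm' sm])
    also have "\<dots> = 2 * K * tail h" unfolding tail_def by (rule suminf_mult[OF summable_shift])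
    finally show ?thesis by (simp add: K_def h_def)
  qed
  with B(1) show ?thesis by (rule that)
qed

text \<open>At total \<open>n\<close> the first count \<open>k\<close> determines the state. The
  number \<open>a\<close> is \<open>\<alpha> * n\<close> rounded up, and
  \<open>k < Suc n - a\<close> says that the second bin holds at least \<open>a\<close>.\<close>

lemma prob_balanced:
  assumes n: "x + y \<le> n" and a: "\<And>k. \<alpha> * real n \<le> real k \<longleftrightarrow> a \<le> k" "2 * a \<le> Suc n"
  shows "prob (balanced \<alpha> n) = (\<Sum>k\<in>{a..<Suc n - a}. prob (visit_event UNIV 0 k (n - k)))"
proof -
  define m where "m = n - (x + y)"
  have an: "k \<le> n" if "k \<in> {a..<Suc n - a}" for k using that by auto
  have V: "visit_event UNIV 0 k (n - k) = {\<omega>. \<omega> m = (k, n - k)}" if "k \<in> {a..<Suc n - a}" for k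
    using an[OF that] by (simp add: visit_event_def m_def)
  have "prob (balanced \<alpha> n) = prob (\<Union>k\<in>{a..<Suc n - a}. visit_event UNIV 0 k (n - k))"
  proof (rule finite_measure_eq_AE)
    show "AE \<omega> in M. \<omega> \<in> balanced \<alpha> n \<longleftrightarrow> \<omega> \<in> (\<Union>k\<in>{a..<Suc n - a}. visit_event UNIV 0 k (n - k))"
      using AE_M
    proof eventually_elim
      case (elim \<omega>)
      obtain k l where kl: "\<omega> m = (k, l)" by (cases "\<omega> m")
      have tot: "k + l = n" using valid_total'[OF elim, of m] kl n by (simp add: m_def)
      have "\<omega> \<in> balanced \<alpha> n \<longleftrightarrow> a \<le> k \<and> a \<le> l"
        unfolding balanced_eq m_def[symmetric] using a(1) kl by simp
      also have "\<dots> \<longleftrightarrow> k \<in> {a..<Suc n - a}" using tot by auto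
      also have "\<dots> \<longleftrightarrow> \<omega> \<in> (\<Union>k\<in>{a..<Suc n - a}. visit_event UNIV 0 k (n - k))"
        using V kl tot by auto
      finally show ?case .
    qed
  qed auto
  also have "\<dots> = (\<Sum>k\<in>{a..<Suc n - a}. prob (visit_event UNIV 0 k (n - k)))"
  proof (rule finite_measure_finite_Union)
    show "disjoint_family_on (\<lambda>k. visit_event UNIV 0 k (n - k)) {a..<Suc n - a}"
      by (auto simp: disjoint_family_on_def V)
  qed auto
  finally show ?thesis .
qed

text \<open>Each visit probability is \<open>green\<close> times
  \<open>1 / f k + 1 / f (n - k)\<close>. Both bins hold at least \<open>a\<close>, so replacing
  \<open>green\<close> by \<open>\<gamma>\<close> costs a relative error of order
  \<open>tail a\<close>.\<close>

lemma prob_balanced_bound: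
  assumes C: "0 \<le> C"
    and lim: "\<And>k l. x + y \<le> k + l \<Longrightarrow> \<bar>green UNIV 0 k l - \<gamma>\<bar> \<le> C * (tail (Suc k) + tail (Suc l))"
    and n: "x + y \<le> n" and a: "\<And>k. \<alpha> * real n \<le> real k \<longleftrightarrow> a \<le> k" "2 * a \<le> Suc n" "0 < a"
  shows "\<bar>prob (balanced \<alpha> n) - 2 * \<gamma> * (tail a - tail (Suc n - a))\<bar>
           \<le> 4 * C * tail a * (tail a - tail (Suc n - a))"
proof -
  let ?I = "{a..<Suc n - a}"
  let ?w = "\<lambda>k. 1 / f k + 1 / f (n - k)"
  have w: "(\<Sum>k\<in>?I. ?w k) = 2 * (tail a - tail (Suc n - a))"
  proof -
    \<comment> \<open>The range is symmetric under exchanging \<open>k\<close> and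
      \<open>n - k\<close>, so both reciprocals contribute the same difference of tails.\<close>
    have "(\<Sum>k\<in>?I. 1 / f (n - k)) = (\<Sum>k\<in>?I. 1 / f k)"
      by (rule sum.reindex_bij_witness[of _ "\<lambda>k. n - k" "\<lambda>k. n - k"]) auto
    then show ?thesis using sum_tail[of a "Suc n - a"] a by (simp add: sum.distrib)
  qed
  have eq: "prob (balanced \<alpha> n) - 2 * \<gamma> * (tail a - tail (Suc n - a)) =
      (\<Sum>k\<in>?I. (green UNIV 0 k (n - k) - \<gamma>) * ?w k)"
  proof -
    have "prob (balanced \<alpha> n) = (\<Sum>k\<in>?I. green UNIV 0 k (n - k) * ?w k)"
      unfolding prob_balanced[OF n a(1,2)] by (intro sum.cong refl prob_visit_event) (use a in auto)
    moreover have "2 * \<gamma> * (tail a - tail (Suc n - a)) = (\<Sum>k\<in>?I. \<gamma> * ?w k)"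
      by (simp only: sum_distrib_left[symmetric] w)
    ultimately show ?thesis by (simp only: sum_subtractf left_diff_distrib)
  qed
  have "\<bar>\<Sum>k\<in>?I. (green UNIV 0 k (n - k) - \<gamma>) * ?w k\<bar> \<le> (\<Sum>k\<in>?I. 2 * C * tail a * ?w k)"
  proof (rule order_trans[OF sum_abs sum_mono])
    fix k assume k: "k \<in> ?I"
    have w0: "0 \<le> ?w k" using f_nonneg by simp
    have "\<bar>green UNIV 0 k (n - k) - \<gamma>\<bar> \<le> C * (tail (Suc k) + tail (Suc (n - k)))"
      using k n by (intro lim) auto
    also have "\<dots> \<le> C * (tail a + tail a)"
      using k by (intro mult_left_mono add_mono tail_antimono C) auto
    finally have "\<bar>green UNIV 0 k (n - k) - \<gamma>\<bar> * ?w k \<le> C * (tail a + tail a) * ?w k"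
      using w0 by (intro mult_right_mono)
    then show "\<bar>(green UNIV 0 k (n - k) - \<gamma>) * ?w k\<bar> \<le> 2 * C * tail a * ?w k"
      using w0 by (simp only: abs_mult abs_of_nonneg) (simp add: algebra_simps)
  qed
  also have "\<dots> = 2 * C * tail a * (2 * (tail a - tail (Suc n - a)))"
    by (simp only: sum_distrib_left[symmetric] w)
  finally show ?thesis unfolding eq by (simp add: algebra_simps)
qed

end

section \<open>Power feedback\<close>

context
  fixes p :: real
  assumes p: "1 < p"
begin

lemma feedback_powr: "feedback (\<lambda>n. real n powr p)"
proof
  fix k l :: nat
  assume "l \<le> k"
  show "real l powr p * real k \<le> real k powr p * real l"
  proof (cases "l = 0")
    case False
    have eq: "real j powr p = real j powr (p - 1) * real j" if "0 < j" for j :: nat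
      using that by (simp add: powr_diff)
    have "real l powr (p - 1) * (real l * real k) \<le> real k powr (p - 1) * (real l * real k)"
      using \<open>l \<le> k\<close> p by (intro mult_right_mono powr_mono2) auto
    then show ?thesis using False \<open>l \<le> k\<close> eq[of k] eq[of l] by (simp add: algebra_simps)
  qed (use p in simp)
next
  show "summable (\<lambda>n. 1 / real n powr p)"
    using p summable_real_powr_iff[of "- p"] by (simp add: powr_minus_divide)
qed (use p in auto)

text \<open>The difference is the integral of \<open>t powr (- p)\<close> from \<open>a\<close> to
  \<open>a + 1\<close>; the mean value theorem replaces it by a value of this decreasing
  function.\<close>

lemma powr_diff_bounds:
  fixes a :: real
  assumes a: "0 < a"
  shows "1 / (a + 1) powr p \<le> a powr (1 - p) / (p - 1) - (a + 1) powr (1 - p) / (p - 1)"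
    and "a powr (1 - p) / (p - 1) - (a + 1) powr (1 - p) / (p - 1) \<le> 1 / a powr p"
proof -
  have "\<exists>z>a. z < a + 1 \<and> (a + 1) powr (1 - p) / (p - 1) - a powr (1 - p) / (p - 1) = (a + 1 - a) * (- (z powr (- p)))"
  proof (rule MVT2)
    fix t assume "a \<le> t" "t \<le> a + 1"
    then have "((\<lambda>t. t powr (1 - p) / (p - 1)) has_real_derivative ((1 - p) * t powr (1 - p - 1) / (p - 1))) (at t)"
      using a p by (auto intro!: derivative_eq_intros)
    moreover have "(1 - p) * t powr (1 - p - 1) / (p - 1) = - (t powr (- p))"
      using p by (simp add: field_simps)
    ultimately show "((\<lambda>t. t powr (1 - p) / (p - 1)) has_real_derivative (- (t powr (- p)))) (at t)" by simp
  qed simp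
  then obtain z where z: "a < z" "z < a + 1"
    "a powr (1 - p) / (p - 1) - (a + 1) powr (1 - p) / (p - 1) = 1 / z powr p"
    by (auto simp: powr_minus_divide)
  show "1 / (a + 1) powr p \<le> a powr (1 - p) / (p - 1) - (a + 1) powr (1 - p) / (p - 1)"
    and "a powr (1 - p) / (p - 1) - (a + 1) powr (1 - p) / (p - 1) \<le> 1 / a powr p"
    unfolding z(3) using z a p by (auto intro!: divide_left_mono powr_mono2)
qed

interpretation feedback "\<lambda>n. real n powr p"
  by (rule feedback_powr)

text \<open>Integral test: the differences in \<open>powr_diff_bounds\<close> telescope, and the
  antiderivative vanishes at infinity.\<close>

lemma tail_powr_bounds:
  assumes m: "0 < m"
  shows "real m powr (1 - p) / (p - 1) \<le> tail m" "tail (Suc m) \<le> real m powr (1 - p) / (p - 1)"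
proof -
  define g where "g j = real (m + j) powr (1 - p) / (p - 1)" for j
  have "(\<lambda>j. real (m + j) powr (1 - p) / (p - 1)) \<longlonglongrightarrow> 0 / (p - 1)"
  proof (intro tendsto_divide tendsto_const)
    have "filterlim (\<lambda>j. real (j + m)) at_top sequentially"
      using filterlim_compose[OF filterlim_real_sequentially] filterlim_add_const_nat_at_top by blast
    then show "(\<lambda>j. real (m + j) powr (1 - p)) \<longlonglongrightarrow> 0"
      using p by (intro tendsto_neg_powr) (simp_all add: add.commute)
  qed (use p in simp)
  then have "(\<lambda>j. g j - g (Suc j)) sums (g 0 - 0)"
    unfolding g_def by (intro telescope_sums') simp
  then have g: "(\<lambda>j. g j - g (Suc j)) sums (real m powr (1 - p) / (p - 1))"
    by (simp add: g_def)
  have b: "1 / real (Suc m + j) powr p \<le> g j - g (Suc j)" "g j - g (Suc j) \<le> 1 / real (m + j) powr p" for j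
    using powr_diff_bounds[of "real (m + j)"] m by (simp_all add: g_def add.assoc add.commute)
  show "real m powr (1 - p) / (p - 1) \<le> tail m"
    unfolding tail_def by (rule sums_le[OF b(2) g summable_sums[OF summable_shift]])
  show "tail (Suc m) \<le> real m powr (1 - p) / (p - 1)"
    unfolding tail_def by (rule sums_le[OF b(1) summable_sums[OF summable_shift] g])
qed

lemma tail_powr_tendsto: "(\<lambda>m. real m powr (p - 1) * tail m) \<longlonglongrightarrow> 1 / (p - 1)"
\<comment> \<open>The limit is taken along \<open>Suc m\<close> because
  \<open>tail_powr_bounds\<close> gives its upper bound at a successor.\<close>
proof (rule LIMSEQ_imp_Suc, rule tendsto_sandwich)
  show "\<forall>\<^sub>F m in sequentially. real (Suc m) powr (p - 1) * tail (Suc m) \<le> (real (Suc m) / real m) powr (p - 1) / (p - 1)"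
    using eventually_gt_at_top[of 0]
  proof eventually_elim
    case (elim m)
    have "real (Suc m) powr (p - 1) * tail (Suc m) \<le> real (Suc m) powr (p - 1) * (real m powr (1 - p) / (p - 1))"
      by (intro mult_left_mono tail_powr_bounds elim) simp
    also have "real m powr (1 - p) = 1 / real m powr (p - 1)"
      using powr_minus_divide[of "real m" "p - 1"] by simp
    finally show ?case by (simp add: powr_divide)
  qed
  show "\<forall>\<^sub>F m in sequentially. 1 / (p - 1) \<le> real (Suc m) powr (p - 1) * tail (Suc m)"
  proof (intro always_eventually allI)
    fix m
    have "real (Suc m) powr (p - 1) * (real (Suc m) powr (1 - p) / (p - 1)) \<le> real (Suc m) powr (p - 1) * tail (Suc m)"
      by (intro mult_left_mono tail_powr_bounds) simp_all
    moreover have "real (Suc m) powr (p - 1) * real (Suc m) powr (1 - p) = 1"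
      by (simp flip: powr_add)
    ultimately show "1 / (p - 1) \<le> real (Suc m) powr (p - 1) * tail (Suc m)" by simp
  qed
  have "(\<lambda>m. (real (Suc m) / real m) powr (p - 1) / (p - 1)) \<longlonglongrightarrow> 1 powr (p - 1) / (p - 1)"
    using p by (intro tendsto_intros LIMSEQ_Suc_n_over_n) auto
  then show "(\<lambda>m. (real (Suc m) / real m) powr (p - 1) / (p - 1)) \<longlonglongrightarrow> 1 / (p - 1)" by simp
qed simp

text \<open>Uses \<open>n powr (p - 1) = (a n / n) powr (1 - p) * a n powr (p - 1)\<close>. The
  tolerance 2 covers all roundings that occur: ceilings, halves and shifts by one.\<close>

lemma tail_powr_scaled:
  assumes \<beta>: "0 < \<beta>" and a: "\<forall>\<^sub>F n in sequentially. \<bar>real (a n) - \<beta> * real n\<bar> \<le> 2"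
  shows "(\<lambda>n. real n powr (p - 1) * tail (a n)) \<longlonglongrightarrow> \<beta> powr (1 - p) / (p - 1)"
    and "filterlim a sequentially sequentially"
proof -
  have "(\<lambda>n. real (a n) / real n - \<beta>) \<longlonglongrightarrow> 0"
  proof (rule Lim_null_comparison)
    show "\<forall>\<^sub>F n in sequentially. norm (real (a n) / real n - \<beta>) \<le> 2 / real n"
      using a eventually_gt_at_top[of 0]
    proof eventually_elim
      case (elim n)
      have "real (a n) / real n - \<beta> = (real (a n) - \<beta> * real n) / real n"
        using elim by (simp add: field_simps)
      then have "norm (real (a n) / real n - \<beta>) = \<bar>real (a n) - \<beta> * real n\<bar> / real n" by simp
      also have "\<dots> \<le> 2 / real n" using elim by (intro divide_right_mono) auto
      finally show ?case .
    qed
    show "(\<lambda>n. 2 / real n) \<longlonglongrightarrow> 0" by (rule lim_const_over_n)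
  qed
  then have lim: "(\<lambda>n. real (a n) / real n) \<longlonglongrightarrow> \<beta>" by (simp add: LIM_zero_iff)
  have "filterlim (\<lambda>n. real (a n) / real n * real n) at_top sequentially"
    by (rule filterlim_tendsto_pos_mult_at_top[OF lim \<beta> filterlim_real_sequentially])
  moreover have "\<forall>\<^sub>F n in sequentially. real (a n) / real n * real n = real (a n)"
    using eventually_gt_at_top[of 0] by eventually_elim simp
  ultimately have "filterlim (\<lambda>n. real (a n)) at_top sequentially"
    by (simp cong: filterlim_cong)
  then show top: "filterlim a sequentially sequentially"
    by (simp add: filterlim_sequentially_iff_filterlim_real)
  have "(\<lambda>n. (real (a n) / real n) powr (1 - p) * (real (a n) powr (p - 1) * tail (a n)))
      \<longlonglongrightarrow> \<beta> powr (1 - p) * (1 / (p - 1))"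
    using \<beta> by (intro tendsto_mult tendsto_powr lim tendsto_const
        filterlim_compose[OF tail_powr_tendsto top]) auto
  moreover have "\<forall>\<^sub>F n in sequentially.
      (real (a n) / real n) powr (1 - p) * (real (a n) powr (p - 1) * tail (a n)) = real n powr (p - 1) * tail (a n)"
    using eventually_gt_at_top[of 0] filterlim_at_top[THEN iffD1, OF top, THEN spec, of 1]
  proof eventually_elim
    case (elim n)
    have "(real (a n) / real n) powr (1 - p) = real (a n) powr (1 - p) * real n powr (p - 1)"
      using elim powr_minus_divide[of "real n" "p - 1"] by (simp add: powr_divide)
    moreover have "real (a n) powr (1 - p) * real (a n) powr (p - 1) = 1"
      using elim by (simp flip: powr_add)
    ultimately show ?case by simp
  qed
  ultimately show "(\<lambda>n. real n powr (p - 1) * tail (a n)) \<longlonglongrightarrow> \<beta> powr (1 - p) / (p - 1)"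
    by (simp add: tendsto_cong)
qed

end

section \<open>From error bounds to asymptotic equivalence\<close>

lemma tendsto_abs_diff_le:
  fixes X Y e :: "nat \<Rightarrow> real"
  assumes "Y \<longlonglongrightarrow> L" "e \<longlonglongrightarrow> 0" "\<forall>\<^sub>F n in sequentially. \<bar>X n - Y n\<bar> \<le> e n"
  shows "X \<longlonglongrightarrow> L"
proof -
  have "(\<lambda>n. X n - Y n) \<longlonglongrightarrow> 0"
    by (rule Lim_null_comparison[OF _ assms(2)]) (use assms(3) in simp)
  from tendsto_add[OF this assms(1)] show ?thesis by simp
qed

lemma asymp_equiv_scaled:
  fixes u v w :: "nat \<Rightarrow> real"
  assumes "(\<lambda>n. w n * u n) \<longlonglongrightarrow> L" "(\<lambda>n. w n * v n) \<longlonglongrightarrow> L" "L \<noteq> 0"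
    and w: "\<forall>\<^sub>F n in sequentially. w n \<noteq> 0"
  shows "u \<sim>[sequentially] v"
proof (rule asymp_equivI')
  have "(\<lambda>n. (w n * u n) / (w n * v n)) \<longlonglongrightarrow> L / L"
    by (intro tendsto_divide assms)
  moreover have "\<forall>\<^sub>F n in sequentially. (w n * u n) / (w n * v n) = u n / v n"
    using w by eventually_elim simp
  ultimately show "(\<lambda>n. u n / v n) \<longlonglongrightarrow> 1"
    using assms(3) by (simp add: tendsto_cong)
qed

theorem corollary3:
  fixes p :: real and f :: "nat \<Rightarrow> real" and x y :: nat
  assumes "p > 1"
    and "\<And>n. f n = real n powr p"
    and "x \<ge> 1" and "y \<ge> 1"
  shows "\<exists>c>0.
      (\<lambda>n. measure (bb_process f (x, y)) {\<omega>. losing_number \<omega> > n})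
        \<sim>[sequentially] (\<lambda>n. c * (\<Sum>j. 1 / f (n + j))) \<and>
      (\<forall>\<alpha>. 0 < \<alpha> \<and> \<alpha> < 1 / 2 \<longrightarrow>
        (\<lambda>n. measure (bb_process f (x, y)) {\<omega>. loser_has_more_than \<alpha> n \<omega>})
          \<sim>[sequentially]
        (\<lambda>n. c * (\<alpha> powr (1 - p) - (1 - \<alpha>) powr (1 - p)) / ((p - 1) * real n powr (p - 1))))"
proof -
  have f: "f = (\<lambda>n. real n powr p)" using assms(2) by auto
  interpret feedback f unfolding f using assms(1) by (rule feedback_powr)
  interpret feedback_process f x y by unfold_locales (use assms(3,4) in auto)
  obtain \<gamma> C where \<gamma>: "0 < \<gamma>" and C: "0 \<le> C"
    and lim: "\<And>k l. x + y \<le> k + l \<Longrightarrow> \<bar>green UNIV 0 k l - \<gamma>\<bar> \<le> C * (tail (Suc k) + tail (Suc l))"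
    by (rule green_limit) (rule that)
  obtain B where B: "0 \<le> B"
    "\<And>\<alpha> n. \<alpha> < 1 / 2 \<Longrightarrow> x + y \<le> n \<Longrightarrow>
       prob (overtaking \<alpha> n) \<le> 2 * B / ((1 - 2 * \<alpha>)\<^sup>2 * real n) * tail (n - n div 2)"
    by (rule prob_overtaking) (rule that)
  define w where "w n = real n powr (p - 1)" for n :: nat
  have w_pos: "\<forall>\<^sub>F n in sequentially. 0 < w n"
    using eventually_gt_at_top[of 0] by eventually_elim (simp add: w_def)
  then have w_neq: "\<forall>\<^sub>F n in sequentially. w n \<noteq> 0" by eventually_elim simp
  have w_nonneg: "0 \<le> w n" for n by (simp add: w_def)
  note scaled = tail_powr_scaled[OF assms(1), folded f w_def]
  have part1: "(\<lambda>n. prob {\<omega>. n < losing_number \<omega>}) \<sim>[sequentially] (\<lambda>n. 2 * \<gamma> * tail n)"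
  proof (rule asymp_equiv_scaled[OF _ _ _ w_neq])
    \<comment> \<open>With \<open>\<beta> = 1\<close> the shift by one disappears in the limit: the
      event \<open>n < losing_number \<omega>\<close> leads to \<open>tail (Suc n)\<close>, while
      the claimed sum starts at \<open>n\<close>.\<close>
    have T: "(\<lambda>n. w n * tail (Suc n)) \<longlonglongrightarrow> 1 / (p - 1)" "(\<lambda>n. w n * tail n) \<longlonglongrightarrow> 1 / (p - 1)"
      using scaled(1)[of 1 Suc] scaled(1)[of 1 "\<lambda>n. n"] by simp_all
    have "(\<lambda>n. 2 * \<gamma> * (w n * tail n)) \<longlonglongrightarrow> 2 * \<gamma> * (1 / (p - 1))"
      by (intro tendsto_intros T)
    then show "(\<lambda>n. w n * (2 * \<gamma> * tail n)) \<longlonglongrightarrow> 2 * \<gamma> / (p - 1)" by (simp add: algebra_simps)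
    show "2 * \<gamma> / (p - 1) \<noteq> 0" using \<gamma> assms(1) by simp
    show "(\<lambda>n. w n * prob {\<omega>. n < losing_number \<omega>}) \<longlonglongrightarrow> 2 * \<gamma> / (p - 1)"
    proof (rule tendsto_abs_diff_le)
      have "(\<lambda>n. 2 * \<gamma> * (w n * tail (Suc n))) \<longlonglongrightarrow> 2 * \<gamma> * (1 / (p - 1))"
        by (intro tendsto_intros T)
      then show "(\<lambda>n. 2 * \<gamma> * (w n * tail (Suc n))) \<longlonglongrightarrow> 2 * \<gamma> / (p - 1)" by simp
      have "(\<lambda>n. 4 * C * tail (Suc n) * (w n * tail (Suc n))) \<longlonglongrightarrow> 4 * C * 0 * (1 / (p - 1))"
        by (intro tendsto_intros T LIMSEQ_Suc tail_tendsto_0)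
      then show "(\<lambda>n. 4 * C * tail (Suc n) * (w n * tail (Suc n))) \<longlonglongrightarrow> 0" by simp
      show "\<forall>\<^sub>F n in sequentially. \<bar>w n * prob {\<omega>. n < losing_number \<omega>} - 2 * \<gamma> * (w n * tail (Suc n))\<bar>
          \<le> 4 * C * tail (Suc n) * (w n * tail (Suc n))"
        using eventually_ge_at_top[of "max x y"]
      proof eventually_elim
        case (elim n)
        have "\<bar>prob {\<omega>. n < losing_number \<omega>} - 2 * \<gamma> * tail (Suc n)\<bar> \<le> 4 * C * tail (Suc n) * tail (Suc n)"
          unfolding prob_losing_number using elim by (intro prob_both_bound C lim) auto
        then have "w n * \<bar>prob {\<omega>. n < losing_number \<omega>} - 2 * \<gamma> * tail (Suc n)\<bar>
            \<le> w n * (4 * C * tail (Suc n) * tail (Suc n))"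
          by (intro mult_left_mono w_nonneg)
        also have "w n * \<bar>prob {\<omega>. n < losing_number \<omega>} - 2 * \<gamma> * tail (Suc n)\<bar> =
            \<bar>w n * prob {\<omega>. n < losing_number \<omega>} - 2 * \<gamma> * (w n * tail (Suc n))\<bar>"
          using w_nonneg[of n] by (simp add: abs_mult_pos' algebra_simps)
        finally show ?case by (simp add: algebra_simps)
      qed
    qed
  qed
  have part2: "(\<lambda>n. prob {\<omega>. loser_has_more_than \<alpha> n \<omega>}) \<sim>[sequentially]
      (\<lambda>n. 2 * \<gamma> * (\<alpha> powr (1 - p) - (1 - \<alpha>) powr (1 - p)) / ((p - 1) * real n powr (p - 1)))"
    if \<alpha>: "0 < \<alpha>" "\<alpha> < 1 / 2" for \<alpha>
  proof (rule asymp_equiv_scaled[OF _ _ _ w_neq])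
    define \<Lambda> where "\<Lambda> = \<alpha> powr (1 - p) / (p - 1) - (1 - \<alpha>) powr (1 - p) / (p - 1)"
    define a where "a n = nat \<lceil>\<alpha> * real n\<rceil>" for n :: nat
    define S where "S n = tail (a n) - tail (Suc n - a n)" for n
    define e where "e n = 4 * C * tail (a n) * S n" for n
    define d where "d n = 2 * B / ((1 - 2 * \<alpha>)\<^sup>2 * real n) * tail (n - n div 2)" for n :: nat
    have a: "\<alpha> * real n \<le> real k \<longleftrightarrow> a n \<le> k" for n k
      unfolding a_def by (simp add: nat_le_iff ceiling_le_iff)
    have a_real: "\<alpha> * real n \<le> real (a n)" "real (a n) < \<alpha> * real n + 1" for n
      using \<alpha>(1) unfolding a_def by (simp_all add: ceiling_less_iff) linarith+
    have small: "\<forall>\<^sub>F n in sequentially. 2 * a n \<le> Suc n \<and> 0 < a n \<and> x + y \<le> n"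
    proof -
      \<comment> \<open>This is where the ceiling satisfies \<open>2 * a n \<le> Suc n\<close>, as
        \<open>prob_balanced_bound\<close> requires.\<close>
      have "\<forall>\<^sub>F n in sequentially. 1 \<le> (1 - 2 * \<alpha>) * real n"
        using eventually_ge_at_top[of "nat \<lceil>1 / (1 - 2 * \<alpha>)\<rceil>"]
      proof eventually_elim
        case (elim n)
        then have "1 / (1 - 2 * \<alpha>) \<le> real n" by (simp add: nat_le_iff ceiling_le_iff)
        then show ?case using \<alpha> by (simp add: field_simps)
      qed
      then show ?thesis using eventually_ge_at_top[of "x + y"] eventually_gt_at_top[of 0]
      proof eventually_elim
        case (elim n)
        have "real (2 * a n) \<le> real (Suc n)" using a_real(2)[of n] elim(1) by (simp add: algebra_simps)
        moreover have "0 < \<alpha> * real n" using \<alpha> elim by simp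
        then have "0 < real (a n)" using a_real(1)[of n] by linarith
        ultimately show ?case using elim by linarith
      qed
    qed
    have "\<bar>real (a n) - \<alpha> * real n\<bar> \<le> 2" for n
      using a_real[of n] by linarith
    then have "\<forall>\<^sub>F n in sequentially. \<bar>real (a n) - \<alpha> * real n\<bar> \<le> 2" by simp
    note lim_a = scaled[OF \<alpha>(1) this]
    have lim_a': "(\<lambda>n. w n * tail (Suc n - a n)) \<longlonglongrightarrow> (1 - \<alpha>) powr (1 - p) / (p - 1)"
    proof (rule scaled(1))
      show "\<forall>\<^sub>F n in sequentially. \<bar>real (Suc n - a n) - (1 - \<alpha>) * real n\<bar> \<le> 2"
        using small
      proof eventually_elim
        case (elim n)
        then have "real (Suc n - a n) = real n + 1 - real (a n)" by (simp add: of_nat_diff)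
        with a_real[of n] show ?case by (simp add: algebra_simps abs_le_iff)
      qed
    qed (use \<alpha> in simp)
    have lim_h: "(\<lambda>n. w n * tail (n - n div 2)) \<longlonglongrightarrow> (1 / 2) powr (1 - p) / (p - 1)"
    proof (rule scaled(1))
      show "\<forall>\<^sub>F n in sequentially. \<bar>real (n - n div 2) - 1 / 2 * real n\<bar> \<le> 2"
      proof (intro always_eventually allI)
        fix n :: nat
        have "n \<le> 2 * (n - n div 2)" "2 * (n - n div 2) \<le> n + 1" by linarith+
        then have "real n \<le> 2 * real (n - n div 2)" "2 * real (n - n div 2) \<le> real n + 1" by linarith+
        then show "\<bar>real (n - n div 2) - 1 / 2 * real n\<bar> \<le> 2" by linarith
      qed
    qed simp
    have lim_S: "(\<lambda>n. w n * S n) \<longlonglongrightarrow> \<Lambda>"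
      using tendsto_diff[OF lim_a(1) lim_a'] by (simp add: S_def \<Lambda>_def algebra_simps)
    have "(1 - \<alpha>) powr (1 - p) < \<alpha> powr (1 - p)"
      using \<alpha> assms(1) by (intro powr_less_mono2_neg) auto
    then have "\<Lambda> \<noteq> 0" using assms(1) by (simp add: \<Lambda>_def)
    then show "2 * \<gamma> * \<Lambda> \<noteq> 0" using \<gamma> by simp
    have "(\<lambda>n. 2 * \<gamma> * \<Lambda>) \<longlonglongrightarrow> 2 * \<gamma> * \<Lambda>" by simp
    moreover have "\<forall>\<^sub>F n in sequentially. 2 * \<gamma> * \<Lambda> =
        w n * (2 * \<gamma> * (\<alpha> powr (1 - p) - (1 - \<alpha>) powr (1 - p)) / ((p - 1) * real n powr (p - 1)))"
      using w_pos by eventually_elim (simp add: w_def \<Lambda>_def diff_divide_distrib[symmetric])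
    ultimately show "(\<lambda>n. w n * (2 * \<gamma> * (\<alpha> powr (1 - p) - (1 - \<alpha>) powr (1 - p)) / ((p - 1) * real n powr (p - 1))))
        \<longlonglongrightarrow> 2 * \<gamma> * \<Lambda>"
      by (rule Lim_transform_eventually)
    show "(\<lambda>n. w n * prob {\<omega>. loser_has_more_than \<alpha> n \<omega>}) \<longlonglongrightarrow> 2 * \<gamma> * \<Lambda>"
    proof (rule tendsto_abs_diff_le)
      show "(\<lambda>n. 2 * \<gamma> * (w n * S n)) \<longlonglongrightarrow> 2 * \<gamma> * \<Lambda>" by (intro tendsto_intros lim_S)
      \<comment> \<open>The first error carries the vanishing factor \<open>tail (a n)\<close>, the
        second the extra \<open>1 / n\<close> from the overtaking estimate.\<close>
      have "(\<lambda>n. 4 * C * tail (a n) * (w n * S n) + 2 * B / (1 - 2 * \<alpha>)\<^sup>2 / real n * (w n * tail (n - n div 2)))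
          \<longlonglongrightarrow> 4 * C * 0 * \<Lambda> + 0 * ((1 / 2) powr (1 - p) / (p - 1))"
        by (intro tendsto_intros lim_S lim_h lim_const_over_n filterlim_compose[OF tail_tendsto_0 lim_a(2)])
      then show "(\<lambda>n. w n * (e n + d n)) \<longlonglongrightarrow> 0"
        by (simp add: e_def d_def algebra_simps)
      show "\<forall>\<^sub>F n in sequentially. \<bar>w n * prob {\<omega>. loser_has_more_than \<alpha> n \<omega>} - 2 * \<gamma> * (w n * S n)\<bar> \<le> w n * (e n + d n)"
        using small
      proof eventually_elim
        case (elim n)
        have "\<bar>prob (balanced \<alpha> n) - 2 * \<gamma> * S n\<bar> \<le> e n"
          unfolding S_def e_def using elim a by (intro prob_balanced_bound C lim) auto
        moreover have "prob (overtaking \<alpha> n) \<le> d n" unfolding d_def using elim \<alpha> by (intro B) auto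
        moreover note prob_loser_has_more_than_bounds[of \<alpha> n]
        ultimately have "\<bar>prob {\<omega>. loser_has_more_than \<alpha> n \<omega>} - 2 * \<gamma> * S n\<bar> \<le> e n + d n"
          using \<alpha> elim measure_nonneg[of M "overtaking \<alpha> n"] by linarith
        then have "w n * \<bar>prob {\<omega>. loser_has_more_than \<alpha> n \<omega>} - 2 * \<gamma> * S n\<bar> \<le> w n * (e n + d n)"
          by (intro mult_left_mono w_nonneg)
        also have "w n * \<bar>prob {\<omega>. loser_has_more_than \<alpha> n \<omega>} - 2 * \<gamma> * S n\<bar> =
            \<bar>w n * prob {\<omega>. loser_has_more_than \<alpha> n \<omega>} - 2 * \<gamma> * (w n * S n)\<bar>"
          using w_nonneg[of n] by (simp add: abs_mult_pos' algebra_simps)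
        finally show ?case .
      qed
    qed
  qed
  show ?thesis
  \<comment> \<open>\<open>\<gamma>\<close> was fixed before \<open>\<alpha>\<close>, so one
    constant serves both claims; the factor 2 comes from the two bins.\<close>
  proof (intro exI[of _ "2 * \<gamma>"] conjI allI impI)
    show "(\<lambda>n. prob {\<omega>. n < losing_number \<omega>}) \<sim>[sequentially] (\<lambda>n. 2 * \<gamma> * (\<Sum>j. 1 / f (n + j)))"
      using part1 unfolding tail_def .
  qed (use \<gamma> part2 in auto)
qed

end
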